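(* Let $\{Y_n\}_{n\ge0}$ be the Markov chain on $\mathbb T$ given by $$Y_{n+1}=f(Y_n)+\omega_n \mod 1,$$ where $f:\mathbb T\to\mathbb R$ is measurable and $\{\omega_n\}_{n\ge0}$ are i.i.d. random variables with a density $h\in C^1(\mathbb T)$ (with respect to Lebesgue measure) satisfying, for some $c_1,c_2>0$, $0<c_1\le h(x)$ and $|h'(x)|\le c_2$ for all $x\in[0,1]$. Then the chain admits a stationary probability measure $\mu$, equivalent to Lebesgue measure, such that its transfer operator $\mathcal P_\mu$ satisfies: (i) there exists $\bar\gamma\in(0,1)$ with $\|\mathcal P_\mu(\phi)\|_{L^2(\mu)}\le\bar\gamma\|\phi\|_{L^2(\mu)}$ for all $\phi\in L^2(\mu)$ with $\int_{\mathbb T}\phi\,d\mu=0$; (ii) $\mathcal P_\mu:L^2(\mu)\to W^{1,2}(\mu)$ is bounded, i.e. there is $C_r>0$ such that for every $\phi\in L^2(\mu)$ the function $\mathcal P_\mu(\phi)$ has a weak derivative $\mathcal P_\mu(\phi)'$ with $\|\mathcal P_\mu(\phi)'\|_{L^2(\mu)}\le C_r\|\phi\|_{L^2(\mu)}$.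
   Context: $\mathbb T$ is the unit circle (one-dimensional torus $\mathbb R/\mathbb Z$, identified with $[0,1]$ with endpoints glued). A Markov chain on $\mathbb T$ with transition kernel $p(x,\cdot)$ acts on finite measures by $\bar p(\nu)(A)=\int_{\mathbb T}p(x,A)\,d\nu(x)$; a stationary measure is a probability measure $\mu$ with $\bar p(\mu)=\mu$. The transfer operator with respect to a stationary measure $\mu$ is $\mathcal P_\mu:L^1(\mu)\to L^1(\mu)$, $\mathcal P_\mu(\phi)=\frac{d\,\bar p(\phi\,d\mu)}{d\mu}$. $W^{1,2}(\mu)=\{\phi\in L^2(\mu):\phi'\in L^2(\mu)\}$, $\phi'$ the weak derivative, with norm $\|\phi\|_{L^2(\mu)}+\|\phi'\|_{L^2(\mu)}$. *)

theory Defs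
  imports "HOL-Probability.Probability"
begin

text \<open>
  The torus $R/Z$ is represented by its fundamental domain $[0,1)$, carrying the Borel sets and
  Lebesgue measure; the projection $R \to R/Z$ is \<^const>\<open>frac\<close>. A measurable function on the
  torus is a function measurable on this space (its values off $[0,1)$ are irrelevant). A function
  with regularity on the torus is a 1-periodic function on the real line, so that regularity
  includes the glued point $0 = 1$.
\<close>

definition torus :: "real measure" where
  "torus = restrict_space lborel {0..<1}"

definition periodic1 :: "(real \<Rightarrow> real) \<Rightarrow> bool" where
  "periodic1 g \<longleftrightarrow> (\<forall>x. g (x + 1) = g x)"

definition C1_torus :: "(real \<Rightarrow> real) \<Rightarrow> bool" where
  "C1_torus g \<longleftrightarrow> periodic1 g \<and> g C1_differentiable_on UNIV"

definition smooth_torus :: "(real \<Rightarrow> real) \<Rightarrow> bool" where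
  "smooth_torus g \<longleftrightarrow> periodic1 g \<and> (\<forall>k x. (deriv ^^ k) g differentiable (at x))"

definition has_weak_derivative :: "(real \<Rightarrow> real) \<Rightarrow> (real \<Rightarrow> real) \<Rightarrow> bool" where
  "has_weak_derivative \<phi> \<phi>' \<longleftrightarrow> integrable torus \<phi> \<and> integrable torus \<phi>' \<and>
     (\<forall>\<psi>. smooth_torus \<psi> \<longrightarrow>
        (\<integral>x. \<phi> x * deriv \<psi> x \<partial>torus) = - (\<integral>x. \<phi>' x * \<psi> x \<partial>torus))"

definition L2 :: "'b measure \<Rightarrow> ('b \<Rightarrow> real) set" where
  "L2 \<mu> = {\<phi> \<in> borel_measurable \<mu>. integrable \<mu> (\<lambda>x. (\<phi> x)\<^sup>2)}"

text \<open>Only meaningful on \<^const>\<open>L2\<close>: the Bochner integral of a non-integrable function is 0.\<close>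

definition L2_norm :: "'b measure \<Rightarrow> ('b \<Rightarrow> real) \<Rightarrow> real" where
  "L2_norm \<mu> \<phi> = sqrt (\<integral>x. (\<phi> x)\<^sup>2 \<partial>\<mu>)"

definition equivalent_measures :: "'b measure \<Rightarrow> 'b measure \<Rightarrow> bool" where
  "equivalent_measures \<mu> \<nu> \<longleftrightarrow> sets \<mu> = sets \<nu> \<and>
     absolutely_continuous \<mu> \<nu> \<and> absolutely_continuous \<nu> \<mu>"

text \<open>
  Transition kernel of $Y_{n+1} = f(Y_n) + \omega_n$ mod 1: \<open>noise_kernel M f W x\<close> is the law of
  $f(x) + W$ mod 1, where $W$ is any one of the (identically distributed) noise variables.
\<close>

definition noise_kernel ::
  "'a measure \<Rightarrow> (real \<Rightarrow> real) \<Rightarrow> ('a \<Rightarrow> real) \<Rightarrow> real \<Rightarrow> real measure" where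
  "noise_kernel M f W x = distr M torus (\<lambda>s. frac (f x + W s))"

text \<open>
  A kernel \<open>p\<close> on \<open>N\<close> is an element of \<open>N \<rightarrow>\<^sub>M prob_algebra N\<close>, and its action on a finite measure
  \<open>\<nu>\<close>, $A \mapsto \int p(x,A)\,d\nu(x)$, is the Giry-monad bind \<open>\<nu> \<bind> p\<close> (see \<open>emeasure_bind\<close>).
\<close>

definition stationary_measure :: "'b measure \<Rightarrow> ('b \<Rightarrow> 'b measure) \<Rightarrow> 'b measure \<Rightarrow> bool" where
  "stationary_measure N p \<mu> \<longleftrightarrow> prob_space \<mu> \<and> sets \<mu> = sets N \<and> \<mu> \<bind> p = \<mu>"

text \<open>
  The Radon-Nikodym derivative with respect to \<open>\<mu>\<close> of the image under \<open>p\<close> of the signed measure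
  $\phi\,d\mu$. As \<^const>\<open>RN_deriv\<close> is for positive measures, the positive and the negative part of
  \<open>\<phi>\<close> are treated separately; note that \<^const>\<open>ennreal\<close> sends negative reals to 0. Lemma
  \<open>transfer_op\<close> below confirms the defining property.
\<close>

definition transfer_op :: "('b \<Rightarrow> 'b measure) \<Rightarrow> 'b measure \<Rightarrow> ('b \<Rightarrow> real) \<Rightarrow> 'b \<Rightarrow> real" where
  "transfer_op p \<mu> \<phi> y =
     enn2real (RN_deriv \<mu> (density \<mu> (\<lambda>x. ennreal (\<phi> x)) \<bind> p) y) -
     enn2real (RN_deriv \<mu> (density \<mu> (\<lambda>x. ennreal (- \<phi> x)) \<bind> p) y)"

lemma sets_torus: "sets torus = sets (restrict_space borel {0..<1})"
  unfolding torus_def by (simp cong: sets_restrict_space_cong)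

lemma space_torus: "space torus = {0..<1}"
  by (simp add: torus_def space_restrict_space)

lemma frac_measurable_torus: "frac \<in> borel \<rightarrow>\<^sub>M torus"
proof -
  have "(\<lambda>x::real. frac x) \<in> borel_measurable borel" unfolding frac_def by measurable
  then show ?thesis
    unfolding measurable_cong_sets[OF refl sets_torus]
    by (intro measurable_restrict_space2) (auto simp: frac_lt_1)
qed

lemma torus_measurable_borel: "g \<in> M \<rightarrow>\<^sub>M torus \<Longrightarrow> g \<in> borel_measurable M"
  unfolding measurable_cong_sets[OF refl sets_torus] by (simp add: measurable_restrict_space2_iff)

lemma noise_kernel_measurable:
  assumes "prob_space M" and f: "f \<in> borel_measurable torus" and W: "W \<in> M \<rightarrow>\<^sub>M torus"
  shows "noise_kernel M f W \<in> torus \<rightarrow>\<^sub>M prob_algebra torus"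
proof -
  interpret prob_space M by fact
  have [measurable]: "W \<in> borel_measurable M" by (rule torus_measurable_borel[OF W])
  have [measurable]: "f \<in> borel_measurable torus" by fact
  have [measurable]: "frac \<in> borel \<rightarrow>\<^sub>M torus" by (rule frac_measurable_torus)
  have M: "(\<lambda>x. M) \<in> torus \<rightarrow>\<^sub>M prob_algebra M"
    by (rule measurable_const) (simp add: space_prob_algebra prob_space_axioms)
  have m: "(\<lambda>(x, s). frac (f x + W s)) \<in> torus \<Otimes>\<^sub>M M \<rightarrow>\<^sub>M torus"
    by (simp add: case_prod_beta')
  show ?thesis
    unfolding noise_kernel_def[abs_def]
    by (rule measurable_distr_prob_space2[OF M m])
qed

lemma RN_bind:
  assumes p: "p \<in> N \<rightarrow>\<^sub>M prob_algebra N" and st: "stationary_measure N p \<mu>"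
    and \<phi>: "integrable \<mu> \<phi>"
  defines "g \<equiv> \<lambda>y. enn2real (RN_deriv \<mu> (density \<mu> (\<lambda>x. ennreal (\<phi> x)) \<bind> p) y)"
  shows "integrable \<mu> g"
    and "A \<in> sets N \<Longrightarrow>
      (\<integral>y\<in>A. g y \<partial>\<mu>) = (\<integral>x. measure (p x) A * max 0 (\<phi> x) \<partial>\<mu>)"
proof -
  interpret prob_space \<mu> using st by (simp add: stationary_measure_def)
  have s: "sets \<mu> = sets N" and bnd: "\<mu> \<bind> p = \<mu>"
    using st by (auto simp: stationary_measure_def)
  let ?D = "density \<mu> (\<lambda>x. ennreal (\<phi> x))"
  let ?B = "?D \<bind> p"
  have [measurable]: "\<phi> \<in> borel_measurable \<mu>" using \<phi> by auto
  have p': "p \<in> \<mu> \<rightarrow>\<^sub>M subprob_algebra N"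
    using measurable_prob_algebraD[OF p] measurable_cong_sets[OF s refl] by blast
  have pD: "p \<in> ?D \<rightarrow>\<^sub>M subprob_algebra N" using p' by simp
  have pp: "prob_space (p x)" "sets (p x) = sets N" if "x \<in> space \<mu>" for x
    using measurable_space[OF p, of x] that sets_eq_imp_space_eq[OF s]
    by (auto simp: space_prob_algebra)
  have sB: "sets ?B = sets \<mu>" unfolding s
    by (rule sets_bind) (use pp(2) not_empty in auto)
  have em [measurable]: "(\<lambda>x. emeasure (p x) A) \<in> borel_measurable \<mu>" if "A \<in> sets N" for A
    using measurable_compose[OF p' measurable_emeasure_subprob_algebra[OF that]] .
  have mm [measurable]: "(\<lambda>x. measure (p x) A) \<in> borel_measurable \<mu>" if "A \<in> sets N" for A
    using measurable_compose[OF p' measurable_measure_subprob_algebra[OF that]] .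
  have eB: "emeasure ?B A = (\<integral>\<^sup>+x. ennreal (\<phi> x) * emeasure (p x) A \<partial>\<mu>)" if A: "A \<in> sets N" for A
    using emeasure_bind[OF _ pD A] not_empty em[OF A] by (simp add: nn_integral_density)
  have ac: "absolutely_continuous \<mu> ?B"
    unfolding absolutely_continuous_def
  proof
    fix A assume "A \<in> null_sets \<mu>"
    then have A: "A \<in> sets N" and z: "emeasure \<mu> A = 0" by (auto simp: s[symmetric])
    have "(\<integral>\<^sup>+x. emeasure (p x) A \<partial>\<mu>) = 0"
      using emeasure_bind[OF not_empty p' A] z bnd by simp
    then have "AE x in \<mu>. emeasure (p x) A = 0"
      using nn_integral_0_iff_AE[OF em[OF A]] by simp
    then have "(\<integral>\<^sup>+x. ennreal (\<phi> x) * emeasure (p x) A \<partial>\<mu>) = 0"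
      using em[OF A] by (subst nn_integral_0_iff_AE) auto
    then show "A \<in> null_sets ?B" using eB[OF A] A sB s by auto
  qed
  have R: "density \<mu> (RN_deriv \<mu> ?B) = ?B"
    using density_RN_deriv[OF ac sB] .
  have fin: "emeasure ?B (space \<mu>) \<noteq> \<infinity>"
  proof -
    have sp: "space \<mu> \<in> sets N" using s by auto
    have "emeasure ?B (space \<mu>) \<le> (\<integral>\<^sup>+x. ennreal (norm (\<phi> x)) \<partial>\<mu>)"
      unfolding eB[OF sp]
    proof (rule nn_integral_mono)
      fix x assume "x \<in> space \<mu>"
      then have "emeasure (p x) (space \<mu>) \<le> 1"
        using pp by (simp add: prob_space.measure_le_1)
      then have "ennreal (\<phi> x) * emeasure (p x) (space \<mu>) \<le> ennreal (\<phi> x) * 1"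
        by (intro mult_left_mono) auto
      also have "\<dots> \<le> ennreal (norm (\<phi> x))" by (simp add: ennreal_leI)
      finally show "ennreal (\<phi> x) * emeasure (p x) (space \<mu>) \<le> ennreal (norm (\<phi> x))" .
    qed
    also have "\<dots> < \<infinity>" using \<phi> by (simp add: integrable_iff_bounded)
    finally show ?thesis by simp
  qed
  have tot: "(\<integral>\<^sup>+y. RN_deriv \<mu> ?B y \<partial>\<mu>) = emeasure ?B (space \<mu>)"
    by (subst R[symmetric], subst emeasure_density) (auto intro!: nn_integral_cong)
  then have AEf: "AE y in \<mu>. RN_deriv \<mu> ?B y \<noteq> \<infinity>"
    using fin by (intro nn_integral_noteq_infinite) auto
  have gm: "g \<in> borel_measurable \<mu>" unfolding g_def by measurable
  have ge: "AE y in \<mu>. ennreal (g y) = RN_deriv \<mu> ?B y"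
    using AEf by eventually_elim (simp add: g_def less_top)
  have "(\<integral>\<^sup>+y. ennreal (g y) \<partial>\<mu>) = emeasure ?B (space \<mu>)"
    unfolding tot[symmetric] by (rule nn_integral_cong_AE) (rule ge)
  then show gi: "integrable \<mu> g"
    using gm fin by (intro integrableI_nonneg) (auto simp: g_def less_top)
  show "(\<integral>y\<in>A. g y \<partial>\<mu>) = (\<integral>x. measure (p x) A * max 0 (\<phi> x) \<partial>\<mu>)" if A: "A \<in> sets N"
  proof -
    have [measurable]: "A \<in> sets \<mu>" using A s by simp
    have "(\<integral>y\<in>A. g y \<partial>\<mu>) = enn2real (\<integral>\<^sup>+y. ennreal (indicator A y * g y) \<partial>\<mu>)"
      unfolding set_lebesgue_integral_def real_scaleR_def using gm
      by (intro integral_eq_nn_integral) (auto simp: g_def)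
    also have "(\<integral>\<^sup>+y. ennreal (indicator A y * g y) \<partial>\<mu>) = (\<integral>\<^sup>+y. RN_deriv \<mu> ?B y * indicator A y \<partial>\<mu>)"
      using ge by (intro nn_integral_cong_AE) (auto split: split_indicator)
    also have "\<dots> = emeasure ?B A"
      by (subst (2) R[symmetric], subst emeasure_density) auto
    also have "\<dots> = (\<integral>\<^sup>+x. ennreal (measure (p x) A * max 0 (\<phi> x)) \<partial>\<mu>)"
      unfolding eB[OF A]
    proof (rule nn_integral_cong)
      fix x assume x: "x \<in> space \<mu>"
      then interpret px: prob_space "p x" using pp by auto
      show "ennreal (\<phi> x) * emeasure (p x) A = ennreal (measure (p x) A * max 0 (\<phi> x))"
        by (cases "\<phi> x \<ge> 0")
           (auto simp: px.emeasure_eq_measure ennreal_mult' mult.commute ennreal_neg)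
    qed
    also have "enn2real \<dots> = (\<integral>x. measure (p x) A * max 0 (\<phi> x) \<partial>\<mu>)"
      using mm[OF A] by (intro integral_eq_nn_integral[symmetric]) auto
    finally show ?thesis .
  qed
qed

lemma transfer_op:
  assumes p: "p \<in> N \<rightarrow>\<^sub>M prob_algebra N" and st: "stationary_measure N p \<mu>"
    and \<phi>: "integrable \<mu> \<phi>"
  shows "integrable \<mu> (transfer_op p \<mu> \<phi>)"
    and "A \<in> sets N \<Longrightarrow>
      (\<integral>y\<in>A. transfer_op p \<mu> \<phi> y \<partial>\<mu>) = (\<integral>x. measure (p x) A * \<phi> x \<partial>\<mu>)"
proof -
  have \<phi>': "integrable \<mu> (\<lambda>x. - \<phi> x)" using \<phi> by simp
  note P = RN_bind[OF p st \<phi>] and Q = RN_bind[OF p st \<phi>']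
  show "integrable \<mu> (transfer_op p \<mu> \<phi>)"
    unfolding transfer_op_def[abs_def] using P(1) Q(1) by (rule Bochner_Integration.integrable_diff)
  show "(\<integral>y\<in>A. transfer_op p \<mu> \<phi> y \<partial>\<mu>) = (\<integral>x. measure (p x) A * \<phi> x \<partial>\<mu>)" if A: "A \<in> sets N"
  proof -
    have s: "sets \<mu> = sets N" using st by (simp add: stationary_measure_def)
    have p': "p \<in> \<mu> \<rightarrow>\<^sub>M subprob_algebra N"
      using measurable_prob_algebraD[OF p] measurable_cong_sets[OF s refl] by blast
    have mm: "(\<lambda>x. measure (p x) A) \<in> borel_measurable \<mu>"
      using measurable_compose[OF p' measurable_measure_subprob_algebra[OF A]] .
    have b: "measure (p x) A \<le> 1" if "x \<in> space \<mu>" for x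
      using measurable_space[OF p', of x] that
      by (auto simp: space_subprob_algebra intro: subprob_space.subprob_measure_le_1)
    have I: "integrable \<mu> (\<lambda>x. measure (p x) A * max 0 (\<psi> x))" if "integrable \<mu> \<psi>" for \<psi>
    proof (rule Bochner_Integration.integrable_bound[OF that])
      show "(\<lambda>x. measure (p x) A * max 0 (\<psi> x)) \<in> borel_measurable \<mu>" using mm that by auto
      show "AE x in \<mu>. norm (measure (p x) A * max 0 (\<psi> x)) \<le> norm (\<psi> x)"
      proof (rule AE_I2)
        fix x assume "x \<in> space \<mu>"
        from b[OF this] have "measure (p x) A * max 0 (\<psi> x) \<le> 1 * max 0 (\<psi> x)"
          by (intro mult_right_mono) auto
        then show "norm (measure (p x) A * max 0 (\<psi> x)) \<le> norm (\<psi> x)" by (simp add: abs_mult)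
      qed
    qed
    have As: "A \<in> sets \<mu>" using A s by simp
    have "(\<integral>y\<in>A. transfer_op p \<mu> \<phi> y \<partial>\<mu>) =
      (\<integral>x. measure (p x) A * max 0 (\<phi> x) \<partial>\<mu>) - (\<integral>x. measure (p x) A * max 0 (- \<phi> x) \<partial>\<mu>)"
      unfolding transfer_op_def P(2)[OF A, symmetric] Q(2)[OF A, symmetric]
      using integrable_mult_indicator[OF As P(1)] integrable_mult_indicator[OF As Q(1)]
      by (intro set_integral_diff) (auto simp: set_integrable_def)
    also have "\<dots> = (\<integral>x. measure (p x) A * max 0 (\<phi> x) - measure (p x) A * max 0 (- \<phi> x) \<partial>\<mu>)"
      using I[OF \<phi>] I[OF \<phi>'] by simp
    also have "\<dots> = (\<integral>x. measure (p x) A * \<phi> x \<partial>\<mu>)"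
      by (rule Bochner_Integration.integral_cong) (auto simp: max_def algebra_simps)
    finally show ?thesis .
  qed
qed

end

theory Submission
  imports Defs
begin

text \<open>
  The kernel has the density $h(y - f(x)) \ge c_1$, so Doeblin's condition yields a stationary density
  $g$ with $c_1 \le g \le \sup h$. With respect to $\mu = g\,dy$ the kernel has the density
  $q(x,y) = h(y - f(x))/g(y)$, bounded below by a constant $\delta > 0$ and of mass 1 in each variable;
  replacing $q$ by $q - \delta$ does not change the operator on mean-zero functions, and
  Cauchy-Schwarz gives the contraction factor $1 - \delta$. For the regularity, $P_\mu \phi = u/g$
  where both $u(y) = \int h(y - f(x)) \phi(x) g(x)\,dx$ and $g$ inherit a bounded derivative from $h$,
  so $u/g$ is $C^1$ on the torus with derivative bounded by a multiple of $\|\phi\|_{L^1(\mu)}$.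
\<close>

text \<open>Two mismatches shape the argument. The Radon-Nikodym derivatives in
  \<open>transfer_op\<close> are determined only almost everywhere, whereas the estimates need a
  function with a value at every point; they are made for the integral operator with kernel
  \<open>q\<close> and carried over by uniqueness of densities. Moreover, the stationary density
  \<open>g\<close> is a mere measurable function on [0,1), while a derivative on the circle calls
  for a periodic function on the line: the integral of h(y - f(x)) g(x) over x makes sense for every
  real y, agrees with \<open>g\<close> on [0,1), and supplies the extension. Since \<open>f\<close>
  is only measurable, nothing can be differentiated in x; all smoothness enters through the variable
  y of h(y - f(x)), by dominated convergence.\<close>

section \<open>Stationary densities from a Doeblin lower bound\<close>

lemma measurable_case_prod_compose:
  assumes "case_prod k \<in> N \<Otimes>\<^sub>M L \<rightarrow>\<^sub>M R" "u \<in> M \<rightarrow>\<^sub>M N" "v \<in> M \<rightarrow>\<^sub>M L"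
  shows "(\<lambda>x. k (u x) (v x)) \<in> M \<rightarrow>\<^sub>M R"
  using measurable_compose[OF measurable_Pair[OF assms(2,3)] assms(1)] by simp

text \<open>Both summands of k = (k - c) + c are nonnegative, so their integrals add, and the finite
  term \<open>ennreal c\<close> may be cancelled. This yields the row mass of the residual
  kernel.\<close>

lemma nn_integral_diff_const:
  assumes "prob_space N" and [measurable]: "k \<in> borel_measurable N"
    and "0 \<le> c" "\<And>y. y \<in> space N \<Longrightarrow> c \<le> k y" "(\<integral>\<^sup>+y. ennreal (k y) \<partial>N) = 1"
  shows "(\<integral>\<^sup>+y. ennreal (k y - c) \<partial>N) = ennreal (1 - c)"
proof -
  interpret prob_space N by fact
  have "1 = (\<integral>\<^sup>+y. ennreal (k y - c) + ennreal c \<partial>N)"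
    unfolding assms(5)[symmetric] using assms(3,4)
    by (intro nn_integral_cong) (simp flip: ennreal_plus)
  also have "\<dots> = (\<integral>\<^sup>+y. ennreal (k y - c) \<partial>N) + ennreal c"
    by (subst nn_integral_add) (auto simp: emeasure_space_1)
  finally have "(\<integral>\<^sup>+y. ennreal (k y - c) \<partial>N) = 1 - ennreal c"
    by (metis ennreal_add_diff_cancel_right ennreal_neq_top)
  then show ?thesis
    using assms(3) by (simp add: ennreal_minus flip: ennreal_1)
qed

text \<open>
  Since \<open>k \<ge> c\<close>, the kernel splits as \<open>c\<close> plus a kernel of mass \<open>1 - c\<close>; the stationary density is
  \<open>c\<close> times the Neumann series of the latter applied to the constant 1. All terms are nonnegative,
  so no convergence has to be established before summing.
\<close>

lemma doeblin_stationary_density: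
  fixes k :: "'b \<Rightarrow> 'b \<Rightarrow> real"
  assumes "prob_space N" and k: "case_prod k \<in> borel_measurable (N \<Otimes>\<^sub>M N)"
    and c: "0 < c"
    and lower: "\<And>x y. x \<in> space N \<Longrightarrow> y \<in> space N \<Longrightarrow> c \<le> k x y"
    and upper: "\<And>x y. x \<in> space N \<Longrightarrow> y \<in> space N \<Longrightarrow> k x y \<le> K"
    and mass: "\<And>x. x \<in> space N \<Longrightarrow> (\<integral>\<^sup>+y. ennreal (k x y) \<partial>N) = 1"
  obtains g where "g \<in> borel_measurable N"
    and "\<And>y. y \<in> space N \<Longrightarrow> c \<le> g y \<and> g y \<le> K"
    and "(\<integral>x. g x \<partial>N) = 1"
    and "\<And>y. y \<in> space N \<Longrightarrow> g y = (\<integral>x. k x y * g x \<partial>N)"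
proof -
  interpret prob_space N by fact
  interpret NN: pair_sigma_finite N N ..
  have k1[measurable]: "(\<lambda>z. k (fst z) (snd z)) \<in> borel_measurable (N \<Otimes>\<^sub>M N)"
    and k2[measurable]: "(\<lambda>z. k (snd z) (fst z)) \<in> borel_measurable (N \<Otimes>\<^sub>M N)"
    by (rule measurable_case_prod_compose[OF k]; measurable)+
  have k3[measurable]: "(\<lambda>x. k x y) \<in> borel_measurable N" "k y \<in> borel_measurable N"
    if "y \<in> space N" for y
    by (rule measurable_case_prod_compose[OF k]; use that in measurable)+
  have resmass: "(\<integral>\<^sup>+y. ennreal (k x y - c) \<partial>N) = ennreal (1 - c)" if x: "x \<in> space N" for x
    using nn_integral_diff_const[OF \<open>prob_space N\<close>] k3[OF x] c lower[OF x] mass[OF x] by simp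
  obtain x0 where x0: "x0 \<in> space N" using not_empty by auto
  \<comment> \<open>Keeps the ratio 1 - c of the geometric series nonnegative: a row of mass 1
    dominates the constant c.\<close>
  have c1: "c \<le> 1"
  proof -
    have "ennreal c = (\<integral>\<^sup>+y. ennreal c \<partial>N)" by (simp add: emeasure_space_1)
    also have "\<dots> \<le> (\<integral>\<^sup>+y. ennreal (k x0 y) \<partial>N)"
      using lower[OF x0] by (intro nn_integral_mono ennreal_leI)
    finally show ?thesis using c by (simp add: mass[OF x0])
  qed
  define r where "r = rec_nat (\<lambda>_. 1) (\<lambda>n r y. \<integral>\<^sup>+x. ennreal (k x y - c) * r x \<partial>N)"
  have r0: "r 0 y = 1" and rS: "r (Suc n) y = (\<integral>\<^sup>+x. ennreal (k x y - c) * r n x \<partial>N)" for n y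
    by (simp_all add: r_def)
  have rm[measurable]: "r n \<in> borel_measurable N" for n
  proof (induction n)
    case 0 then show ?case by (simp add: r_def)
  next
    case (Suc n)
    note Suc[measurable]
    have "(\<lambda>y. \<integral>\<^sup>+x. ennreal (k x y - c) * r n x \<partial>N) \<in> borel_measurable N"
      by (rule borel_measurable_nn_integral) (simp add: case_prod_beta')
    then show ?case unfolding rS[abs_def] .
  qed
  \<comment> \<open>By Tonelli the arrival point y is integrated out first, and every row of k - c
    has mass 1 - c.\<close>
  have ri: "(\<integral>\<^sup>+y. r n y \<partial>N) = ennreal ((1 - c) ^ n)" for n
  proof (induction n)
    case 0 then show ?case by (simp add: r0 emeasure_space_1)
  next
    case (Suc n)
    have "(\<integral>\<^sup>+y. r (Suc n) y \<partial>N) = (\<integral>\<^sup>+x. \<integral>\<^sup>+y. ennreal (k x y - c) * r n x \<partial>N \<partial>N)"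
      unfolding rS by (rule NN.Fubini') (simp add: case_prod_beta')
    also have "\<dots> = (\<integral>\<^sup>+x. ennreal (1 - c) * r n x \<partial>N)"
      by (intro nn_integral_cong) (simp add: nn_integral_multc resmass)
    finally show ?case using c1 by (simp add: nn_integral_cmult Suc ennreal_mult)
  qed
  \<comment> \<open>The masses (1 - c)^n sum to 1/c, so the factor c normalises G to mass 1.\<close>
  define G where "G y = ennreal c * (\<Sum>n. r n y)" for y
  have Gm[measurable]: "G \<in> borel_measurable N" unfolding G_def[abs_def] by measurable
  have "(\<integral>\<^sup>+y. G y \<partial>N) = ennreal c * (\<Sum>n. ennreal ((1 - c) ^ n))"
    unfolding G_def by (simp add: nn_integral_cmult nn_integral_suminf ri)
  also have "(\<Sum>n. ennreal ((1 - c) ^ n)) = ennreal (1 / c)"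
    using c c1 geometric_sums[of "1 - c"] by (intro suminf_ennreal_eq) auto
  finally have Gi: "(\<integral>\<^sup>+y. G y \<partial>N) = 1" using c by (simp flip: ennreal_mult)
  \<comment> \<open>The residual part of the kernel shifts the series by one; the constant part
    contributes c times the mass of G, which is exactly the missing term n = 0.\<close>
  have Gfix: "G y = (\<integral>\<^sup>+x. ennreal (k x y) * G x \<partial>N)" if y: "y \<in> space N" for y
  proof -
    note [measurable] = k3[OF y]
    have "(\<integral>\<^sup>+x. ennreal (k x y) * G x \<partial>N) =
        (\<integral>\<^sup>+x. ennreal (k x y - c) * G x + ennreal c * G x \<partial>N)"
      using c lower[OF _ y]
      by (intro nn_integral_cong) (simp flip: distrib_right ennreal_plus)
    also have "\<dots> = (\<integral>\<^sup>+x. ennreal (k x y - c) * G x \<partial>N) + ennreal c"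
      by (simp add: nn_integral_add nn_integral_cmult Gi)
    also have "(\<integral>\<^sup>+x. ennreal (k x y - c) * G x \<partial>N) =
        (\<integral>\<^sup>+x. ennreal c * (\<Sum>n. ennreal (k x y - c) * r n x) \<partial>N)"
      by (simp add: G_def ac_simps)
    also have "\<dots> = ennreal c * (\<Sum>n. r (Suc n) y)"
      unfolding rS by (simp add: nn_integral_cmult nn_integral_suminf del: ennreal_suminf_cmult)
    also have "\<dots> + ennreal c = ennreal c * ((\<Sum>n. r (Suc n) y) + r 0 y)"
      by (simp add: r0 distrib_left)
    also have "(\<Sum>n. r (Suc n) y) + r 0 y = (\<Sum>n. r n y)"
      using suminf_offset[of "\<lambda>n. r n y" 1] by simp
    finally show ?thesis by (simp add: G_def)
  qed
  \<comment> \<open>The fixed-point equation makes G y an average of \<open>k x y\<close> against a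
    density of mass 1, so it inherits the bounds of k.\<close>
  have Gb: "ennreal c \<le> G y \<and> G y \<le> ennreal K" if y: "y \<in> space N" for y
  proof
    have "ennreal c = (\<integral>\<^sup>+x. ennreal c * G x \<partial>N)" by (simp add: nn_integral_cmult Gi)
    also have "\<dots> \<le> G y"
      unfolding Gfix[OF y] using lower[OF _ y]
      by (intro nn_integral_mono mult_right_mono ennreal_leI) auto
    finally show "ennreal c \<le> G y" .
    have "G y \<le> (\<integral>\<^sup>+x. ennreal K * G x \<partial>N)"
      unfolding Gfix[OF y] using upper[OF _ y]
      by (intro nn_integral_mono mult_right_mono ennreal_leI) auto
    then show "G y \<le> ennreal K" by (simp add: nn_integral_cmult Gi)
  qed
  define g where "g y = enn2real (G y)" for y
  have gG: "ennreal (g y) = G y" if "y \<in> space N" for y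
  proof -
    have "G y < top" by (rule le_less_trans[OF conjunct2[OF Gb[OF that]]]) simp
    then show ?thesis by (simp add: g_def)
  qed
  have g0: "0 \<le> g y" for y by (simp add: g_def)
  have gm[measurable]: "g \<in> borel_measurable N" unfolding g_def[abs_def] by measurable
  \<comment> \<open>\<open>ennreal\<close> sends negative reals to 0, so the upper bound descends to
    the reals only for nonnegative K.\<close>
  have K0: "0 \<le> K" using lower[OF x0 x0] upper[OF x0 x0] c by linarith
  show ?thesis
  proof (rule that)
    show "g \<in> borel_measurable N" by (rule gm)
    show "c \<le> g y \<and> g y \<le> K" if "y \<in> space N" for y
      using Gb[OF that] K0 g0[of y] by (simp flip: gG[OF that])
    have "(\<integral>\<^sup>+x. ennreal (g x) \<partial>N) = 1"
      by (simp add: gG Gi cong: nn_integral_cong)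
    then show "(\<integral>x. g x \<partial>N) = 1"
      by (subst integral_eq_nn_integral) (auto simp: g0)
    show "g y = (\<integral>x. k x y * g x \<partial>N)" if y: "y \<in> space N" for y
    proof -
      note [measurable] = k3[OF y]
      have "(\<integral>x. k x y * g x \<partial>N) = enn2real (\<integral>\<^sup>+x. ennreal (k x y * g x) \<partial>N)"
        using lower[OF _ y] c g0
        by (intro integral_eq_nn_integral AE_I2)
           (auto intro!: mult_nonneg_nonneg intro: order_trans[OF less_imp_le[OF c]])
      also have "(\<integral>\<^sup>+x. ennreal (k x y * g x) \<partial>N) = (\<integral>\<^sup>+x. ennreal (k x y) * G x \<partial>N)"
        using g0 by (intro nn_integral_cong) (simp add: ennreal_mult'' flip: gG)
      finally show ?thesis by (simp add: g_def Gfix[OF y, symmetric])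
    qed
  qed
qed

section \<open>Square-integrable functions on a probability space\<close>

text \<open>With s the mass of w and a the weighted integral of \<phi>, the nonnegative integral of
  w (s \<phi> - a)^2 expands to s (s b - a^2); dividing by s > 0 gives the claim.\<close>

lemma weighted_Cauchy_Schwarz:
  fixes w \<phi> :: "'b \<Rightarrow> real"
  assumes w: "\<And>x. x \<in> space N \<Longrightarrow> 0 \<le> w x" "0 < (\<integral>x. w x \<partial>N)"
    and [simp]: "integrable N w" "integrable N (\<lambda>x. w x * \<phi> x)" "integrable N (\<lambda>x. w x * (\<phi> x)\<^sup>2)"
  shows "(\<integral>x. w x * \<phi> x \<partial>N)\<^sup>2 \<le> (\<integral>x. w x \<partial>N) * (\<integral>x. w x * (\<phi> x)\<^sup>2 \<partial>N)"
proof -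
  define s where "s = (\<integral>x. w x \<partial>N)"
  define a where "a = (\<integral>x. w x * \<phi> x \<partial>N)"
  define b where "b = (\<integral>x. w x * (\<phi> x)\<^sup>2 \<partial>N)"
  have "0 \<le> (\<integral>x. w x * (s * \<phi> x - a)\<^sup>2 \<partial>N)"
    using w(1) by (intro integral_nonneg_AE AE_I2) auto
  also have "\<dots> = (\<integral>x. s\<^sup>2 * (w x * (\<phi> x)\<^sup>2) - 2 * s * a * (w x * \<phi> x) + a\<^sup>2 * w x \<partial>N)"
    by (simp add: power2_eq_square algebra_simps)
  also have "\<dots> = s\<^sup>2 * b - 2 * s * a * a + a\<^sup>2 * s"
    by (simp add: s_def a_def b_def)
  also have "\<dots> = s * (s * b - a\<^sup>2)"
    by (simp add: power2_eq_square algebra_simps)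
  finally show ?thesis
    using w(2) by (simp add: zero_le_mult_iff flip: s_def a_def b_def)
qed

text \<open>Cauchy-Schwarz with weight 1. Kernel estimates naturally produce integrals of |\<phi>|;
  this turns them into bounds by \<open>L2_norm\<close>.\<close>

lemma (in prob_space) integral_abs_le_L2_norm:
  assumes "\<phi> \<in> L2 M"
  shows "integrable M \<phi>" and "(\<integral>x. \<bar>\<phi> x\<bar> \<partial>M) \<le> L2_norm M \<phi>"
proof -
  have sq: "integrable M (\<lambda>x. (\<phi> x)\<^sup>2)" and m: "\<phi> \<in> borel_measurable M"
    using assms by (auto simp: L2_def)
  show i: "integrable M \<phi>" using square_integrable_imp_integrable[OF m sq] .
  have "(\<integral>x. \<bar>\<phi> x\<bar> \<partial>M)\<^sup>2 \<le> (\<integral>x. (\<phi> x)\<^sup>2 \<partial>M)"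
    using weighted_Cauchy_Schwarz[of M "\<lambda>_. 1" "\<lambda>x. \<bar>\<phi> x\<bar>"] i sq by (simp add: prob_space)
  then show "(\<integral>x. \<bar>\<phi> x\<bar> \<partial>M) \<le> L2_norm M \<phi>"
    unfolding L2_norm_def by (rule real_le_rsqrt)
qed

lemma (in prob_space) L2_bounded:
  assumes m: "\<psi> \<in> borel_measurable M" and b: "AE x in M. \<bar>\<psi> x\<bar> \<le> C"
  shows "\<psi> \<in> L2 M" and "L2_norm M \<psi> \<le> C"
proof -
  have b2: "AE x in M. (\<psi> x)\<^sup>2 \<le> C\<^sup>2"
    using b by eventually_elim (metis abs_ge_zero power2_abs power_mono)
  \<comment> \<open>On a space of mass 1 a statement free of x that holds almost everywhere is true;
    the sign of C is needed to undo the square.\<close>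
  have "AE x in M. 0 \<le> C"
    using b by eventually_elim linarith
  then have C: "0 \<le> C" by simp
  have i: "integrable M (\<lambda>x. (\<psi> x)\<^sup>2)"
    by (rule integrable_const_bound[of _ "C\<^sup>2"]) (use b2 m in auto)
  then show "\<psi> \<in> L2 M" using m by (simp add: L2_def)
  have "(\<integral>x. (\<psi> x)\<^sup>2 \<partial>M) \<le> (\<integral>x. C\<^sup>2 \<partial>M)"
    using i b2 by (intro integral_mono_AE) auto
  then show "L2_norm M \<psi> \<le> C"
    unfolding L2_norm_def using C by (simp add: prob_space real_le_lsqrt)
qed

text \<open>Carries membership and norm from the explicit integral operator to
  \<open>transfer_op\<close>, which equals it only almost everywhere.\<close>

lemma L2_cong_AE:
  assumes "AE x in N. \<phi> x = \<psi> x" "\<phi> \<in> borel_measurable N" "\<psi> \<in> borel_measurable N"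
  shows "\<phi> \<in> L2 N \<longleftrightarrow> \<psi> \<in> L2 N" and "L2_norm N \<phi> = L2_norm N \<psi>"
proof -
  have ae: "AE x in N. (\<phi> x)\<^sup>2 = (\<psi> x)\<^sup>2" using assms(1) by eventually_elim simp
  show "\<phi> \<in> L2 N \<longleftrightarrow> \<psi> \<in> L2 N"
    using assms(2,3) integrable_cong_AE[OF _ _ ae] by (auto simp: L2_def)
  show "L2_norm N \<phi> = L2_norm N \<psi>"
    unfolding L2_norm_def using integral_cong_AE[OF _ _ ae] assms(2,3) by auto
qed

section \<open>The integral operator of a kernel with unit rows and columns\<close>

text \<open>
  \<open>q\<close> is the density of the transition kernel with respect to the stationary measure; stationarity
  is the assumption \<open>col\<close>.
\<close>

locale stationary_density = prob_space +
  fixes q :: "'a \<Rightarrow> 'a \<Rightarrow> real" and \<delta> B :: real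
  assumes q_measurable: "case_prod q \<in> borel_measurable (M \<Otimes>\<^sub>M M)"
    and \<delta>: "0 < \<delta>" "\<delta> < 1"
    and lower: "\<And>x y. x \<in> space M \<Longrightarrow> y \<in> space M \<Longrightarrow> \<delta> \<le> q x y"
    and upper: "\<And>x y. x \<in> space M \<Longrightarrow> y \<in> space M \<Longrightarrow> q x y \<le> B"
    and row: "\<And>x. x \<in> space M \<Longrightarrow> (\<integral>y. q x y \<partial>M) = 1"
    and col: "\<And>y. y \<in> space M \<Longrightarrow> (\<integral>x. q x y \<partial>M) = 1"
begin

sublocale pair: pair_sigma_finite M M ..

text \<open>The action on densities relative to M: the starting point x is integrated out, the
  arrival point y remains.\<close>

definition T :: "('a \<Rightarrow> real) \<Rightarrow> 'a \<Rightarrow> real" where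
  "T \<phi> y = (\<integral>x. q x y * \<phi> x \<partial>M)"

lemma q_meas [measurable]:
  "(\<lambda>z. q (fst z) (snd z)) \<in> borel_measurable (M \<Otimes>\<^sub>M M)"
  "(\<lambda>z. q (snd z) (fst z)) \<in> borel_measurable (M \<Otimes>\<^sub>M M)"
  "y \<in> space M \<Longrightarrow> (\<lambda>x. q x y) \<in> borel_measurable M"
  "y \<in> space M \<Longrightarrow> q y \<in> borel_measurable M"
  by (rule measurable_case_prod_compose[OF q_measurable]; measurable)+

lemma q_nonneg: "x \<in> space M \<Longrightarrow> y \<in> space M \<Longrightarrow> 0 \<le> q x y"
  using lower[of x y] \<delta> by linarith

lemma abs_q_le: "x \<in> space M \<Longrightarrow> y \<in> space M \<Longrightarrow> \<bar>q x y\<bar> \<le> B"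
  using q_nonneg[of x y] upper[of x y] by simp

lemma integrable_q_mult:
  assumes y: "y \<in> space M" and \<phi>: "integrable M \<phi>"
  shows "integrable M (\<lambda>x. q x y * \<phi> x)" "integrable M (\<lambda>x. q y x * \<phi> x)"
  using y \<phi>
  by (auto intro!: Bochner_Integration.integrable_bound[OF integrable_mult_right[OF \<phi>, of B]]
      AE_I2 mult_right_mono order_trans[OF abs_q_le abs_ge_self] simp: abs_mult)

lemma integrable_q:
  assumes "y \<in> space M"
  shows "integrable M (\<lambda>x. q x y)" "integrable M (q y)"
  using integrable_q_mult[OF assms, of "\<lambda>_. 1"] by simp_all

lemma nn_integral_q:
  assumes "y \<in> space M"
  shows "(\<integral>\<^sup>+x. ennreal (q x y) \<partial>M) = 1" "(\<integral>\<^sup>+x. ennreal (q y x) \<partial>M) = 1"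
  using nn_integral_eq_integral[OF integrable_q(1)[OF assms]]
    nn_integral_eq_integral[OF integrable_q(2)[OF assms]] q_nonneg assms
  by (simp_all add: row col AE_I2)

text \<open>After Tonelli the inner integral runs over x, where \<open>col\<close> gives 1, and only
  the measure of A is left.\<close>

lemma bind_stationary:
  assumes p: "p \<in> M \<rightarrow>\<^sub>M subprob_algebra M"
    and pq: "\<And>x. x \<in> space M \<Longrightarrow> p x = density M (\<lambda>y. ennreal (q x y))"
  shows "M \<bind> p = M"
proof (rule measure_eqI)
  show s: "sets (M \<bind> p) = sets M"
    by (rule sets_bind) (use pq not_empty in auto)
  fix A assume "A \<in> sets (M \<bind> p)"
  then have A[measurable]: "A \<in> sets M" using s by simp
  have "emeasure (M \<bind> p) A = (\<integral>\<^sup>+x. emeasure (p x) A \<partial>M)"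
    by (rule emeasure_bind[OF not_empty p A])
  also have "\<dots> = (\<integral>\<^sup>+x. \<integral>\<^sup>+y. ennreal (q x y) * indicator A y \<partial>M \<partial>M)"
    by (intro nn_integral_cong) (simp add: pq emeasure_density)
  also have "\<dots> = (\<integral>\<^sup>+y. \<integral>\<^sup>+x. ennreal (q x y) * indicator A y \<partial>M \<partial>M)"
    by (rule pair.Fubini'[symmetric]) (simp add: case_prod_beta')
  also have "\<dots> = (\<integral>\<^sup>+y. indicator A y \<partial>M)"
    by (intro nn_integral_cong) (simp add: nn_integral_multc nn_integral_q)
  finally show "emeasure (M \<bind> p) A = emeasure M A" by simp
qed

lemma T_measurable:
  assumes [measurable]: "\<phi> \<in> borel_measurable M"
  shows "T \<phi> \<in> borel_measurable M"
  unfolding T_def[abs_def]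
  by (rule borel_measurable_lebesgue_integral) (simp add: case_prod_beta')

text \<open>Boundedness of q upgrades integrable functions to bounded ones; integrability and
  square-integrability of \<open>T \<phi>\<close> both rest on this.\<close>

lemma abs_T_le:
  assumes "integrable M \<phi>" and y: "y \<in> space M"
  shows "\<bar>T \<phi> y\<bar> \<le> B * (\<integral>x. \<bar>\<phi> x\<bar> \<partial>M)"
proof -
  have "\<bar>T \<phi> y\<bar> \<le> (\<integral>x. \<bar>q x y * \<phi> x\<bar> \<partial>M)"
    unfolding T_def by (rule integral_abs_bound)
  also have "\<dots> \<le> (\<integral>x. B * \<bar>\<phi> x\<bar> \<partial>M)"
    using assms abs_q_le[OF _ y] integrable_abs[OF integrable_q_mult(1)[OF y assms(1)]]
    by (intro integral_mono) (auto simp: abs_mult intro!: mult_right_mono)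
  finally show ?thesis by simp
qed

lemma integrable_T: "integrable M \<phi> \<Longrightarrow> integrable M (T \<phi>)"
  by (rule integrable_const_bound[OF AE_I2]) (auto intro: abs_T_le T_measurable)

text \<open>Two integrable functions with equal integrals over every measurable set agree almost
  everywhere; for \<open>transfer_op\<close> these integrals are its defining property, for T they
  come from Fubini.\<close>

lemma transfer_op_AE_eq_T:
  assumes p: "p \<in> N \<rightarrow>\<^sub>M prob_algebra N" and st: "stationary_measure N p M"
    and pq: "\<And>x. x \<in> space M \<Longrightarrow> p x = density M (\<lambda>y. ennreal (q x y))"
    and \<phi>: "integrable M \<phi>"
  shows "AE y in M. transfer_op p M \<phi> y = T \<phi> y"
proof (rule density_unique_real)
  show "integrable M (transfer_op p M \<phi>)" by (rule transfer_op(1)[OF p st \<phi>])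
  show "integrable M (T \<phi>)" by (rule integrable_T[OF \<phi>])
  fix A assume A[measurable]: "A \<in> sets M"
  have "sets M = sets N" using st unfolding stationary_measure_def by blast
  then have AN: "A \<in> sets N" using A by (rule subst)
  have [measurable]: "\<phi> \<in> borel_measurable M" using \<phi> by simp
  \<comment> \<open>Mass 1 in the second factor makes \<phi>, read in the first coordinate,
    integrable on the product; B times it dominates the integrand to be interchanged.\<close>
  have 1: "integrable (M \<Otimes>\<^sub>M M) (\<lambda>z. \<phi> (fst z))"
    by (rule pair.Fubini_integrable) (use \<phi> in \<open>auto simp: prob_space\<close>)
  have 2: "integrable (M \<Otimes>\<^sub>M M) (\<lambda>(x, y). indicator A y * q x y * \<phi> x)"
    by (rule Bochner_Integration.integrable_bound[OF integrable_mult_right[OF 1, of B]])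
       (auto simp: space_pair_measure abs_mult case_prod_beta' intro!: AE_I2 mult_right_mono
         intro: order_trans[OF abs_q_le] split: split_indicator)
  have "(\<integral>x. measure (p x) A * \<phi> x \<partial>M) = (\<integral>x. \<integral>y. indicator A y * q x y * \<phi> x \<partial>M \<partial>M)"
  proof (intro Bochner_Integration.integral_cong refl)
    fix x assume x: "x \<in> space M"
    note [measurable] = q_meas(4)[OF x]
    have "measure (p x) A = enn2real (\<integral>\<^sup>+y. ennreal (indicator A y * q x y) \<partial>M)"
      by (auto simp: pq[OF x] measure_def emeasure_density intro!: arg_cong[of _ _ enn2real] nn_integral_cong
          split: split_indicator)
    also have "\<dots> = (\<integral>y. indicator A y * q x y \<partial>M)"
      using q_nonneg[OF x] by (intro integral_eq_nn_integral[symmetric] AE_I2) auto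
    finally show "measure (p x) A * \<phi> x = (\<integral>y. indicator A y * q x y * \<phi> x \<partial>M)" by simp
  qed
  also have "\<dots> = (\<integral>y. \<integral>x. indicator A y * q x y * \<phi> x \<partial>M \<partial>M)"
    by (rule pair.Fubini_integral[OF 2, symmetric])
  also have "\<dots> = (\<integral>y\<in>A. T \<phi> y \<partial>M)"
    unfolding set_lebesgue_integral_def T_def by (simp add: mult.assoc)
  finally show "(\<integral>y\<in>A. transfer_op p M \<phi> y \<partial>M) = (\<integral>y\<in>A. T \<phi> y \<partial>M)"
    by (simp add: transfer_op(2)[OF p st \<phi> AN])
qed

text \<open>
  On mean-zero functions \<open>q\<close> may be replaced by \<open>q - \<delta>\<close>, whose rows and columns have mass \<open>1 - \<delta>\<close>;
  the two factors \<open>1 - \<delta>\<close> come from Cauchy-Schwarz and from integrating in \<open>y\<close>.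
\<close>

lemma T_contraction:
  assumes \<phi>: "\<phi> \<in> L2 M" and mean: "(\<integral>x. \<phi> x \<partial>M) = 0"
  shows "L2_norm M (T \<phi>) \<le> (1 - \<delta>) * L2_norm M \<phi>"
proof -
  have [measurable]: "\<phi> \<in> borel_measurable M" and sq: "integrable M (\<lambda>x. (\<phi> x)\<^sup>2)"
    using \<phi> by (auto simp: L2_def)
  have i: "integrable M \<phi>" by (rule integral_abs_le_L2_norm[OF \<phi>])
  have sqm: "integrable M (\<lambda>y. \<integral>x. (q x y - \<delta>) * (\<phi> x)\<^sup>2 \<partial>M)"
    and fub: "(\<integral>y. \<integral>x. (q x y - \<delta>) * (\<phi> x)\<^sup>2 \<partial>M \<partial>M) = (\<integral>x. \<integral>y. (q x y - \<delta>) * (\<phi> x)\<^sup>2 \<partial>M \<partial>M)"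
  proof -
    have 1: "integrable (M \<Otimes>\<^sub>M M) (\<lambda>z. (\<phi> (fst z))\<^sup>2)"
      by (rule pair.Fubini_integrable) (use sq in \<open>auto simp: prob_space\<close>)
    have "integrable (M \<Otimes>\<^sub>M M) (\<lambda>(x, y). (q x y - \<delta>) * (\<phi> x)\<^sup>2)"
    proof (rule Bochner_Integration.integrable_bound[OF integrable_mult_right[OF 1, of B]])
      show "AE z in M \<Otimes>\<^sub>M M. norm (case z of (x, y) \<Rightarrow> (q x y - \<delta>) * (\<phi> x)\<^sup>2) \<le> norm (B * (\<phi> (fst z))\<^sup>2)"
      proof (rule AE_I2, clarsimp simp: space_pair_measure abs_mult)
        fix x y assume "x \<in> space M" "y \<in> space M"
        then have "\<bar>q x y - \<delta>\<bar> \<le> \<bar>B\<bar>" using lower[of x y] upper[of x y] \<delta> by linarith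
        then show "\<bar>q x y - \<delta>\<bar> * (\<phi> x)\<^sup>2 \<le> \<bar>B\<bar> * (\<phi> x)\<^sup>2" by (rule mult_right_mono) simp
      qed
    qed (simp add: case_prod_beta')
    then show "integrable M (\<lambda>y. \<integral>x. (q x y - \<delta>) * (\<phi> x)\<^sup>2 \<partial>M)"
      and "(\<integral>y. \<integral>x. (q x y - \<delta>) * (\<phi> x)\<^sup>2 \<partial>M \<partial>M) = (\<integral>x. \<integral>y. (q x y - \<delta>) * (\<phi> x)\<^sup>2 \<partial>M \<partial>M)"
      by (rule pair.integrable_snd, rule pair.Fubini_integral)
  qed
  have pointwise: "(T \<phi> y)\<^sup>2 \<le> (1 - \<delta>) * (\<integral>x. (q x y - \<delta>) * (\<phi> x)\<^sup>2 \<partial>M)" if y: "y \<in> space M" for y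
  proof -
    have mass: "(\<integral>x. q x y - \<delta> \<partial>M) = 1 - \<delta>"
      using integrable_q[OF y] by (simp add: col[OF y] prob_space)
    have "T \<phi> y = (\<integral>x. (q x y - \<delta>) * \<phi> x \<partial>M)"
      using integrable_q_mult(1)[OF y i] i by (simp add: T_def left_diff_distrib mean)
    then show ?thesis
      using weighted_Cauchy_Schwarz[of M "\<lambda>x. q x y - \<delta>" \<phi>] integrable_q(1)[OF y]
        integrable_q_mult(1)[OF y i] integrable_q_mult(1)[OF y sq] i sq \<delta> lower[OF _ y]
      by (simp add: mass left_diff_distrib)
  qed
  have "(\<integral>y. (T \<phi> y)\<^sup>2 \<partial>M) \<le> (\<integral>y. (1 - \<delta>) * (\<integral>x. (q x y - \<delta>) * (\<phi> x)\<^sup>2 \<partial>M) \<partial>M)"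
  proof (rule integral_mono)
    have "T \<phi> \<in> L2 M"
      by (rule L2_bounded[OF T_measurable AE_I2]) (auto intro: abs_T_le[OF i])
    then show "integrable M (\<lambda>y. (T \<phi> y)\<^sup>2)" by (simp add: L2_def)
  qed (use sqm pointwise in auto)
  also have "\<dots> = (1 - \<delta>) * (\<integral>x. \<integral>y. (q x y - \<delta>) * (\<phi> x)\<^sup>2 \<partial>M \<partial>M)"
    by (simp add: fub)
  also have "(\<integral>x. \<integral>y. (q x y - \<delta>) * (\<phi> x)\<^sup>2 \<partial>M \<partial>M) = (\<integral>x. (1 - \<delta>) * (\<phi> x)\<^sup>2 \<partial>M)"
    using integrable_q by (intro Bochner_Integration.integral_cong) (simp_all add: row prob_space)
  finally have "(\<integral>y. (T \<phi> y)\<^sup>2 \<partial>M) \<le> (1 - \<delta>)\<^sup>2 * (\<integral>x. (\<phi> x)\<^sup>2 \<partial>M)"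
    by (simp add: power2_eq_square)
  then have "L2_norm M (T \<phi>) \<le> sqrt ((1 - \<delta>)\<^sup>2 * (\<integral>x. (\<phi> x)\<^sup>2 \<partial>M))"
    unfolding L2_norm_def by (rule real_sqrt_le_mono)
  also have "\<dots> = (1 - \<delta>) * L2_norm M \<phi>"
    using \<delta> by (simp add: real_sqrt_mult L2_norm_def)
  finally show ?thesis .
qed

end

section \<open>Integration over the torus, periodic functions and the law of the rotated
  noise\<close>

lemma measurable_torusI: "g \<in> borel_measurable borel \<Longrightarrow> g \<in> borel_measurable torus"
  unfolding torus_def by (intro measurable_restrict_space1) simp

lemma nn_integral_torus: "(\<integral>\<^sup>+x. g x \<partial>torus) = (\<integral>\<^sup>+x. g x * indicator {0..<1} x \<partial>lborel)"
  unfolding torus_def by (rule nn_integral_restrict_space) simp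

text \<open>The endpoint 1 is a null set; the closed interval is the form in which integration by
  parts applies.\<close>

lemma integral_torus:
  fixes g :: "real \<Rightarrow> real"
  shows "(\<integral>x. g x \<partial>torus) = (\<integral>x. indicator {0..1} x * g x \<partial>lborel)"
proof -
  have "(\<integral>x. g x \<partial>torus) = (\<integral>x. indicator {0..<1} x * g x \<partial>lborel)"
    unfolding torus_def by (subst integral_restrict_space) auto
  also have "\<dots> = (\<integral>x. indicator {0..1} x * g x \<partial>lborel)"
    by (rule integral_discrete_difference[of "{1}"]) (auto split: split_indicator)
  finally show ?thesis .
qed

lemma prob_space_torus: "prob_space torus"
  by (rule prob_spaceI) (simp add: space_torus, simp add: torus_def emeasure_restrict_space)

text \<open>On the fundamental domain a rotation by b = frac a exchanges two intervals: [0,1-b) is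
  shifted onto [b,1) and [1-b,1) onto [0,b).\<close>

lemma nn_integral_torus_translate:
  assumes [measurable]: "u \<in> borel_measurable borel"
  shows "(\<integral>\<^sup>+t. u (frac (a + t)) \<partial>torus) = (\<integral>\<^sup>+y. u y \<partial>torus)"
proof -
  define b where "b = frac a"
  have b: "0 \<le> b" "b < 1" by (simp_all add: b_def frac_lt_1)
  have fr: "frac (a + t) = (if b + t < 1 then b + t else b + t - 1)" if "t \<in> {0..<1}" for t
  proof -
    have "b + t = a + t + of_int (- \<lfloor>a\<rfloor>)" by (simp add: b_def frac_def)
    then have "frac (a + t) = frac (b + t)" by (simp only: frac_add_of_int_right)
    also have "\<dots> = (if b + t < 1 then b + t else b + t - 1)"
    proof (cases "b + t < 1")
      case True then show ?thesis using b that by (simp add: frac_eq)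
    next
      case False
      then have "\<lfloor>b + t\<rfloor> = 1" using b that by (intro floor_unique) auto
      then show ?thesis using False by (simp add: frac_def)
    qed
    finally show ?thesis .
  qed
  have "(\<integral>\<^sup>+t. u (frac (a + t)) \<partial>torus) =
      (\<integral>\<^sup>+t. u (b + t) * indicator {0..<1-b} t + u (b + t - 1) * indicator {1-b..<1} t \<partial>lborel)"
    unfolding nn_integral_torus using b
    by (intro nn_integral_cong) (auto split: split_indicator simp: fr)
  also have "\<dots> = (\<integral>\<^sup>+t. u (b + t) * indicator {0..<1-b} t \<partial>lborel) +
      (\<integral>\<^sup>+t. u (b + t - 1) * indicator {1-b..<1} t \<partial>lborel)"
    by (rule nn_integral_add) measurable
  also have "(\<integral>\<^sup>+t. u (b + t) * indicator {0..<1-b} t \<partial>lborel) = (\<integral>\<^sup>+y. u y * indicator {b..<1} y \<partial>lborel)"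
    by (subst (2) nn_integral_real_affine[of _ 1 b])
       (auto intro!: nn_integral_cong split: split_indicator)
  also have "(\<integral>\<^sup>+t. u (b + t - 1) * indicator {1-b..<1} t \<partial>lborel) = (\<integral>\<^sup>+y. u y * indicator {0..<b} y \<partial>lborel)"
    by (subst (2) nn_integral_real_affine[of _ 1 "b - 1"])
       (auto intro!: nn_integral_cong split: split_indicator simp: algebra_simps)
  also have "(\<integral>\<^sup>+y. u y * indicator {b..<1} y \<partial>lborel) + (\<integral>\<^sup>+y. u y * indicator {0..<b} y \<partial>lborel) =
      (\<integral>\<^sup>+y. u y * indicator {b..<1} y + u y * indicator {0..<b} y \<partial>lborel)"
    by (rule nn_integral_add[symmetric]) measurable
  also have "\<dots> = (\<integral>\<^sup>+y. u y \<partial>torus)"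
    unfolding nn_integral_torus using b by (intro nn_integral_cong) (auto split: split_indicator)
  finally show ?thesis .
qed

text \<open>Induction extends the shift by 1 to natural shifts; applied at y - m these also give the
  negative ones.\<close>

lemma periodic1_frac:
  assumes "periodic1 g" shows "g (frac x) = g x"
proof -
  have n: "g (y + real n) = g y" for y n
  proof (induction n)
    case (Suc n)
    have "y + real (Suc n) = (y + real n) + 1" by simp
    then show ?case using assms Suc by (simp only: periodic1_def)
  qed simp
  have "g (y + of_int k) = g y" for y k
    by (cases k rule: int_cases2) (use n[of y] n[of "y - real m" m for m] in auto)
  from this[of "frac x" "\<lfloor>x\<rfloor>"] show ?thesis by (simp add: frac_def)
qed

text \<open>Compactness of one period. This is the source of the upper bound for the noise
  density.\<close>

lemma periodic1_bounded:
  assumes "periodic1 g" "continuous_on UNIV g"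
  obtains C where "\<And>x. \<bar>g x\<bar> \<le> C"
proof -
  have "compact (g ` {0..1})"
    using assms(2) by (intro compact_continuous_image) (auto intro: continuous_on_subset)
  then obtain C where C: "\<And>x. x \<in> {0..1} \<Longrightarrow> \<bar>g x\<bar> \<le> C"
    by (metis compact_imp_bounded bounded_real imageI)
  show thesis
  proof (rule that)
    fix x
    have "\<bar>g (frac x)\<bar> \<le> C" by (rule C) (simp add: frac_lt_1 less_imp_le)
    then show "\<bar>g x\<bar> \<le> C" by (simp add: periodic1_frac[OF assms(1)])
  qed
qed

text \<open>The law is the image of the noise law under a rotation, which preserves Lebesgue
  measure, so only the density gets translated.\<close>

lemma distr_torus_translate_density:
  assumes per: "periodic1 h" and cont: "continuous_on UNIV h"
    and W: "distributed M torus W (\<lambda>x. ennreal (h x))"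
  shows "distr M torus (\<lambda>s. frac (a + W s)) = density torus (\<lambda>y. ennreal (h (y - a)))"
proof (rule measure_eqI)
  have [measurable]: "h \<in> borel_measurable borel" by (rule borel_measurable_continuous_onI[OF cont])
  have [measurable]: "W \<in> M \<rightarrow>\<^sub>M torus" using W by (simp add: distributed_def)
  have [measurable]: "frac \<in> borel \<rightarrow>\<^sub>M torus" by (rule frac_measurable_torus)
  have [measurable]: "(\<lambda>x. x) \<in> torus \<rightarrow>\<^sub>M borel" by (rule measurable_torusI) simp
  have fm[measurable]: "(\<lambda>t. frac (a + t)) \<in> torus \<rightarrow>\<^sub>M torus" by measurable
  \<comment> \<open>The difference may leave [0,1), but it differs from t by an integer, which
    periodicity of h absorbs.\<close>
  have hs: "h (frac (a + t) - a) = h t" for t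
  proof -
    have "h (frac (a + t) - a) = h (frac (frac (a + t) - a))" by (simp add: periodic1_frac[OF per])
    also have "frac (frac (a + t) - a) = frac (t + of_int (- \<lfloor>a + t\<rfloor>))"
      by (simp add: frac_def algebra_simps)
    also have "\<dots> = frac t" by (rule frac_add_of_int_right)
    finally show ?thesis by (simp add: periodic1_frac[OF per])
  qed
  fix A assume "A \<in> sets (distr M torus (\<lambda>s. frac (a + W s)))"
  then have A[measurable]: "A \<in> sets torus" by simp
  \<comment> \<open>Rotation invariance asks for an integrand that is Borel on the whole line, so A
    must be a Borel set of the line.\<close>
  then obtain A' where A': "A' \<in> sets borel" "A = A' \<inter> {0..<1}"
    by (auto simp: sets_torus sets_restrict_space)
  then have [measurable]: "A \<in> sets borel" by simp
  have "distr M torus (\<lambda>s. frac (a + W s)) = distr (distr M torus W) torus (\<lambda>t. frac (a + t))"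
    by (subst distr_distr) (auto simp: comp_def)
  also have "\<dots> = distr (density torus (\<lambda>x. ennreal (h x))) torus (\<lambda>t. frac (a + t))"
    using W by (simp add: distributed_def)
  finally have "emeasure (distr M torus (\<lambda>s. frac (a + W s))) A =
      (\<integral>\<^sup>+t. ennreal (h t) * indicator A (frac (a + t)) \<partial>torus)"
    using fm by (simp add: nn_integral_distr nn_integral_density flip: nn_integral_indicator)
  also have "\<dots> = (\<integral>\<^sup>+t. (\<lambda>y. ennreal (h (y - a)) * indicator A y) (frac (a + t)) \<partial>torus)"
    by (simp add: hs)
  also have "\<dots> = (\<integral>\<^sup>+y. ennreal (h (y - a)) * indicator A y \<partial>torus)"
    by (rule nn_integral_torus_translate) measurable
  also have "\<dots> = emeasure (density torus (\<lambda>y. ennreal (h (y - a)))) A"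
    by (subst emeasure_density) measurable
  finally show "emeasure (distr M torus (\<lambda>s. frac (a + W s))) A =
      emeasure (density torus (\<lambda>y. ennreal (h (y - a)))) A" .
qed simp

section \<open>Smoothness of integrals of translates, and weak derivatives\<close>

lemma continuous_integral_translate:
  fixes h :: "real \<Rightarrow> real"
  assumes cont: "continuous_on UNIV h" and bound: "\<And>x. \<bar>h x\<bar> \<le> C"
    and f[measurable]: "f \<in> borel_measurable N" and w: "integrable N w"
  shows "isCont (\<lambda>y. \<integral>x. h (y - f x) * w x \<partial>N) y"
  unfolding isCont_def tendsto_at_iff_sequentially comp_def
proof (intro allI impI)
  fix X :: "nat \<Rightarrow> real" assume X: "X \<longlonglongrightarrow> y"
  have [measurable]: "h \<in> borel_measurable borel" by (rule borel_measurable_continuous_onI[OF cont])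
  have [measurable]: "w \<in> borel_measurable N" using w by simp
  show "(\<lambda>n. \<integral>x. h (X n - f x) * w x \<partial>N) \<longlonglongrightarrow> (\<integral>x. h (y - f x) * w x \<partial>N)"
  proof (rule integral_dominated_convergence)
    show "integrable N (\<lambda>x. C * \<bar>w x\<bar>)" using w by simp
    show "AE x in N. (\<lambda>n. h (X n - f x) * w x) \<longlonglongrightarrow> h (y - f x) * w x"
      using cont X by (intro AE_I2 tendsto_intros continuous_on_tendsto_compose[OF cont]) auto
    show "AE x in N. norm (h (X n - f x) * w x) \<le> C * \<bar>w x\<bar>" for n
      using bound by (auto intro!: AE_I2 mult_right_mono simp: abs_mult)
  qed measurable
qed

text \<open>The bound on h' makes h Lipschitz with constant C', so C' |w| dominates all difference
  quotients and the limit passes under the integral.\<close>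

lemma DERIV_integral_translate:
  fixes h h' :: "real \<Rightarrow> real"
  assumes h: "\<And>x. (h has_real_derivative h' x) (at x)" and cont': "continuous_on UNIV h'"
    and bound: "\<And>x. \<bar>h x\<bar> \<le> C" and bound': "\<And>x. \<bar>h' x\<bar> \<le> C'"
    and f[measurable]: "f \<in> borel_measurable N" and w: "integrable N w"
  shows "((\<lambda>y. \<integral>x. h (y - f x) * w x \<partial>N) has_real_derivative (\<integral>x. h' (y - f x) * w x \<partial>N)) (at y)"
  unfolding DERIV_def tendsto_at_iff_sequentially comp_def
proof (intro allI impI)
  fix X :: "nat \<Rightarrow> real" assume X: "\<forall>i. X i \<in> UNIV - {0}" "X \<longlonglongrightarrow> 0"
  have cont: "continuous_on UNIV h"
    by (rule DERIV_continuous_on[of _ _ h']) (rule has_field_derivative_at_within[OF h])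
  have [measurable]: "h \<in> borel_measurable borel" "h' \<in> borel_measurable borel"
    by (rule borel_measurable_continuous_onI[OF cont], rule borel_measurable_continuous_onI[OF cont'])
  have [measurable]: "w \<in> borel_measurable N" using w by simp
  have int: "integrable N (\<lambda>x. h (z - f x) * w x)" for z
    by (rule Bochner_Integration.integrable_bound[of _ "\<lambda>x. C * w x"])
       (use w bound in \<open>auto intro!: AE_I2 mult_right_mono intro: order_trans[OF bound abs_ge_self] simp: abs_mult\<close>)
  have lip: "\<bar>h (z + d) - h z\<bar> \<le> C' * \<bar>d\<bar>" for z d
    using field_differentiable_bound[of UNIV h h' C' "z + d" z] h bound'
    by (auto intro: has_field_derivative_at_within)
  \<comment> \<open>Holds for d = 0 as well, where both sides are 0 by the convention for division
    by zero.\<close>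
  have eq: "((\<integral>x. h (y + d - f x) * w x \<partial>N) - (\<integral>x. h (y - f x) * w x \<partial>N)) / d =
      (\<integral>x. (h (y - f x + d) - h (y - f x)) / d * w x \<partial>N)" for d
  proof -
    have *: "(h (y - f x + d) - h (y - f x)) / d * w x = (h (y + d - f x) * w x - h (y - f x) * w x) / d" for x
      by (simp add: algebra_simps diff_divide_distrib)
    show ?thesis unfolding * using int[of "y + d"] int[of y] by simp
  qed
  show "(\<lambda>n. ((\<integral>x. h (y + X n - f x) * w x \<partial>N) - (\<integral>x. h (y - f x) * w x \<partial>N)) / X n)
      \<longlonglongrightarrow> (\<integral>x. h' (y - f x) * w x \<partial>N)"
    unfolding eq
  proof (rule integral_dominated_convergence)
    show "integrable N (\<lambda>x. C' * \<bar>w x\<bar>)" using w by simp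
    show "AE x in N. (\<lambda>n. (h (y - f x + X n) - h (y - f x)) / X n * w x) \<longlonglongrightarrow> h' (y - f x) * w x"
    proof (intro AE_I2 tendsto_mult tendsto_const)
      fix x
      show "(\<lambda>n. (h (y - f x + X n) - h (y - f x)) / X n) \<longlonglongrightarrow> h' (y - f x)"
        by (rule h[of "y - f x", unfolded DERIV_def tendsto_at_iff_sequentially comp_def,
              THEN spec[of _ X], THEN mp, THEN mp, OF X])
    qed
    show "AE x in N. norm ((h (y - f x + X n) - h (y - f x)) / X n * w x) \<le> C' * \<bar>w x\<bar>" for n
    proof (rule AE_I2)
      fix x
      have "0 < \<bar>X n\<bar>" using X(1) by auto
      then have "\<bar>(h (y - f x + X n) - h (y - f x)) / X n\<bar> \<le> C'"
        unfolding abs_divide by (rule mult_imp_div_pos_le[OF _ lip])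
      then show "norm ((h (y - f x + X n) - h (y - f x)) / X n * w x) \<le> C' * \<bar>w x\<bar>"
        unfolding real_norm_def abs_mult[of _ "w x"] by (rule mult_right_mono) (rule abs_ge_zero)
    qed
  qed measurable
qed

text \<open>Integration by parts over one period; the boundary terms cancel because F and the test
  function are both periodic.\<close>

lemma has_weak_derivative_C1:
  assumes F: "\<And>x. (F has_real_derivative F' x) (at x)" and cont: "\<And>x. isCont F' x"
    and per: "periodic1 F" and ae: "AE x in torus. \<phi> x = F x"
    and \<phi>: "\<phi> \<in> borel_measurable torus"
  shows "has_weak_derivative \<phi> F'"
proof -
  have cF: "continuous_on UNIV F"
    by (rule DERIV_continuous_on[of _ _ F']) (rule has_field_derivative_at_within[OF F])
  have cF': "continuous_on UNIV F'" using cont by (simp add: continuous_on_eq_continuous_at)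
  have F1: "F 1 = F 0" using per[unfolded periodic1_def, rule_format, of 0] by simp
  have int: "integrable torus g" if g: "continuous_on UNIV g" for g :: "real \<Rightarrow> real"
  proof -
    have "integrable lborel (\<lambda>x. indicator {0..1} x *\<^sub>R g x)"
      by (rule borel_integrable_compact) (auto intro: continuous_on_subset[OF g])
    then have "integrable lborel (\<lambda>x. indicator {0..<1} x *\<^sub>R g x)"
      by (rule integrable_discrete_difference[of "{1}", THEN iffD1, rotated -1])
         (auto split: split_indicator)
    then show ?thesis
      unfolding torus_def by (subst integrable_restrict_space) auto
  qed
  have i\<phi>: "integrable torus \<phi>"
    using int[OF cF] integrable_cong_AE[OF \<phi> _ ae] by auto
  have "(\<integral>x. \<phi> x * deriv \<psi> x \<partial>torus) = - (\<integral>x. F' x * \<psi> x \<partial>torus)" if \<psi>: "smooth_torus \<psi>" for \<psi>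
  proof -
    have D: "(deriv ^^ k) \<psi> differentiable (at x)" for k x
      using \<psi> by (simp add: smooth_torus_def)
    have d0: "(\<psi> has_real_derivative deriv \<psi> x) (at x)" for x
      using D[of 0 x] by (simp add: DERIV_deriv_iff_real_differentiable)
    have d1: "isCont (deriv \<psi>) x" for x
      using D[of 1 x] by (auto intro: differentiable_imp_continuous_within)
    have p1: "\<psi> 1 = \<psi> 0"
      using \<psi> periodic1_def[of \<psi>] by (metis add_0 smooth_torus_def)
    have m: "deriv \<psi> \<in> borel_measurable torus"
      using d1 by (intro measurable_torusI borel_measurable_continuous_onI)
        (simp add: continuous_on_eq_continuous_at)
    have "(\<integral>x. \<phi> x * deriv \<psi> x \<partial>torus) = (\<integral>x. F x * deriv \<psi> x \<partial>torus)"
      using ae m \<phi> int[OF cF] by (intro integral_cong_AE) auto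
    also have "\<dots> = F 1 * \<psi> 1 - F 0 * \<psi> 0 - (\<integral>x. F' x * \<psi> x \<partial>torus)"
      unfolding integral_torus
      using integral_by_parts'[of 0 1 F' "deriv \<psi>" F \<psi>] cont d1 F d0 by simp
    finally show ?thesis by (simp add: F1 p1)
  qed
  then show ?thesis
    unfolding has_weak_derivative_def using i\<phi> int[OF cF'] by simp
qed

lemma abs_integral_translate_le:
  fixes h :: "real \<Rightarrow> real"
  assumes "\<And>x. \<bar>h x\<bar> \<le> C" and w: "integrable N w"
  shows "\<bar>\<integral>x. h (y - f x) * w x \<partial>N\<bar> \<le> C * (\<integral>x. \<bar>w x\<bar> \<partial>N)"
proof -
  have "\<bar>\<integral>x. h (y - f x) * w x \<partial>N\<bar> \<le> (\<integral>x. \<bar>h (y - f x) * w x\<bar> \<partial>N)"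
    by (rule integral_abs_bound)
  also have "\<dots> \<le> (\<integral>x. C * \<bar>w x\<bar> \<partial>N)"
    using w order_trans[OF abs_ge_zero assms(1)]
    by (intro integral_mono') (auto simp: abs_mult intro!: mult_right_mono assms(1))
  finally show ?thesis by simp
qed

text \<open>Quotient rule with G \<ge> c. With a the integral of |w|, |u'| \<le> C' a gives the term
  C'/c; |u| \<le> C a and |G'| \<le> C', the latter by the normalisation of |g|, give C
  C'/c^2.\<close>

lemma quotient_integral_translate_C1:
  fixes N :: "'b measure" and h h' :: "real \<Rightarrow> real" and f g w :: "'b \<Rightarrow> real"
  defines "G \<equiv> \<lambda>y. \<integral>x. h (y - f x) * g x \<partial>N" and "u \<equiv> \<lambda>y. \<integral>x. h (y - f x) * w x \<partial>N"
  assumes h: "\<And>x. (h has_real_derivative h' x) (at x)" and cont': "continuous_on UNIV h'"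
    and bound: "\<And>x. \<bar>h x\<bar> \<le> C" and bound': "\<And>x. \<bar>h' x\<bar> \<le> C'"
    and f: "f \<in> borel_measurable N" and g: "integrable N g" "(\<integral>x. \<bar>g x\<bar> \<partial>N) = 1"
    and w: "integrable N w" and c: "0 < c" "\<And>y. c \<le> G y"
  obtains F' where "\<And>y. ((\<lambda>y. u y / G y) has_real_derivative F' y) (at y)"
    and "\<And>y. isCont F' y"
    and "\<And>y. \<bar>F' y\<bar> \<le> (C' / c + C * C' / c\<^sup>2) * (\<integral>x. \<bar>w x\<bar> \<partial>N)"
proof -
  define G' where "G' = (\<lambda>y. \<integral>x. h' (y - f x) * g x \<partial>N)"
  define u' where "u' = (\<lambda>y. \<integral>x. h' (y - f x) * w x \<partial>N)"
  define a where "a = (\<integral>x. \<bar>w x\<bar> \<partial>N)"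
  have a0: "0 \<le> a" by (simp add: a_def)
  have Gne: "G y \<noteq> 0" for y using c(1) c(2)[of y] by simp
  have dG: "(G has_real_derivative G' y) (at y)" for y
    unfolding G_def G'_def by (rule DERIV_integral_translate[OF h cont' bound bound' f g(1)])
  have du: "(u has_real_derivative u' y) (at y)" for y
    unfolding u_def u'_def by (rule DERIV_integral_translate[OF h cont' bound bound' f w])
  have cont: "isCont G y" "isCont u y" "isCont G' y" "isCont u' y" for y
    using DERIV_isCont[OF dG] DERIV_isCont[OF du]
      continuous_integral_translate[OF cont' bound' f g(1)] continuous_integral_translate[OF cont' bound' f w]
    by (simp_all add: G'_def u'_def)
  have b: "\<bar>u y\<bar> \<le> C * a" "\<bar>u' y\<bar> \<le> C' * a" "\<bar>G' y\<bar> \<le> C'" for y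
    using abs_integral_translate_le[of h, OF bound w] abs_integral_translate_le[of h', OF bound' w]
      abs_integral_translate_le[of h', OF bound' g(1)]
    by (simp_all add: u_def u'_def G'_def a_def g(2))
  define F' where "F' y = u' y / G y - u y * G' y / (G y)\<^sup>2" for y
  show thesis
  proof (rule that)
    show "((\<lambda>y. u y / G y) has_real_derivative F' y) (at y)" for y
      by (rule derivative_eq_intros du dG Gne refl)+
         (use Gne[of y] in \<open>simp add: F'_def field_simps power2_eq_square\<close>)
    show "isCont F' y" for y
      unfolding F'_def[abs_def] by (intro continuous_intros cont) (use Gne[of y] in auto)
    show "\<bar>F' y\<bar> \<le> (C' / c + C * C' / c\<^sup>2) * (\<integral>x. \<bar>w x\<bar> \<partial>N)" for y
    proof -
      have Gc: "c \<le> \<bar>G y\<bar>" "c\<^sup>2 \<le> (G y)\<^sup>2"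
        using c(1) c(2)[of y] by (auto intro: power_mono)
      have C0: "0 \<le> C" using order_trans[OF abs_ge_zero bound[of 0]] .
      have "\<bar>F' y\<bar> \<le> \<bar>u' y / G y\<bar> + \<bar>u y * G' y / (G y)\<^sup>2\<bar>"
        unfolding F'_def by (rule abs_triangle_ineq4)
      also have "\<bar>u' y / G y\<bar> \<le> C' * a / c"
        unfolding abs_divide
        using frac_le[OF order_trans[OF abs_ge_zero b(2)] b(2) c(1) Gc(1)] .
      also have "\<bar>u y * G' y / (G y)\<^sup>2\<bar> \<le> (C * a) * C' / c\<^sup>2"
      proof -
        have "\<bar>u y * G' y\<bar> \<le> (C * a) * C'"
          unfolding abs_mult by (intro mult_mono b) (use C0 a0 in auto)
        then show ?thesis
          unfolding abs_divide using c(1) Gc(2) by (intro frac_le) (auto intro: order_trans[OF abs_ge_zero])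
      qed
      finally show ?thesis by (simp add: a_def algebra_simps)
    qed
  qed
qed

section \<open>The noisy circle map: stationary measure, contraction and regularisation\<close>

theorem corollary2p3:
  fixes M :: "'a measure" and Y \<omega> :: "nat \<Rightarrow> 'a \<Rightarrow> real"
    and f h :: "real \<Rightarrow> real" and c1 c2 :: real
  assumes "prob_space M"
    and "f \<in> borel_measurable torus"
    and "\<And>n s. s \<in> space M \<Longrightarrow> Y (Suc n) s = frac (f (Y n s) + \<omega> n s)"
    and "prob_space.indep_vars M (\<lambda>_. torus) (\<lambda>i. case i of 0 \<Rightarrow> Y 0 | Suc n \<Rightarrow> \<omega> n) UNIV"
    and "\<And>n. distributed M torus (\<omega> n) (\<lambda>x. ennreal (h x))"
    and "C1_torus h"
    and "c1 > 0" and "c2 > 0"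
    and "\<And>x. x \<in> {0..1} \<Longrightarrow> c1 \<le> h x"
    and "\<And>x. x \<in> {0..1} \<Longrightarrow> \<bar>deriv h x\<bar> \<le> c2"
  defines "p \<equiv> noise_kernel M f (\<omega> 0)"
  shows "\<exists>\<mu>. stationary_measure torus p \<mu> \<and> equivalent_measures \<mu> torus \<and>
    (\<exists>\<gamma>. 0 < \<gamma> \<and> \<gamma> < 1 \<and>
      (\<forall>\<phi>\<in>L2 \<mu>. (\<integral>x. \<phi> x \<partial>\<mu>) = 0 \<longrightarrow>
        transfer_op p \<mu> \<phi> \<in> L2 \<mu> \<and>
        L2_norm \<mu> (transfer_op p \<mu> \<phi>) \<le> \<gamma> * L2_norm \<mu> \<phi>)) \<and>
    (\<exists>C\<^sub>r>0. \<exists>C>0. \<forall>\<phi>\<in>L2 \<mu>.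
      transfer_op p \<mu> \<phi> \<in> L2 \<mu> \<and>
      (\<exists>\<phi>'\<in>L2 \<mu>. has_weak_derivative (transfer_op p \<mu> \<phi>) \<phi>' \<and>
        L2_norm \<mu> \<phi>' \<le> C\<^sub>r * L2_norm \<mu> \<phi> \<and>
        L2_norm \<mu> (transfer_op p \<mu> \<phi>) + L2_norm \<mu> \<phi>' \<le> C * L2_norm \<mu> \<phi>))"
proof -
  interpret M: prob_space M by fact
  interpret torus: prob_space torus by (rule prob_space_torus)
  note f[measurable] = \<open>f \<in> borel_measurable torus\<close>
  have id[measurable]: "(\<lambda>x. x) \<in> borel_measurable torus" by (rule measurable_torusI) simp
  have per: "periodic1 h" using \<open>C1_torus h\<close> by (simp add: C1_torus_def)
  obtain D where D: "\<And>x. (h has_real_derivative D x) (at x)" and D_cont: "continuous_on UNIV D"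
    using \<open>C1_torus h\<close>
    by (auto simp: C1_torus_def C1_differentiable_on_def has_real_derivative_iff_has_vector_derivative)
  have D_eq: "deriv h = D" using DERIV_imp_deriv[OF D] by auto
  \<comment> \<open>Needed to spread the derivative bound from [0,1] to the whole line, since y -
    f(x) is an arbitrary real.\<close>
  have per': "periodic1 D"
    unfolding periodic1_def
  proof
    fix x
    have "((\<lambda>y. h (y + 1)) has_real_derivative D (x + 1)) (at x)"
      using D[of "x + 1"] by (simp add: DERIV_shift)
    moreover have "(\<lambda>y. h (y + 1)) = h" using per by (auto simp: periodic1_def)
    ultimately show "D (x + 1) = D x" using D[of x] DERIV_unique by metis
  qed
  have fr01: "frac x \<in> {0..1}" for x :: real by (simp add: frac_lt_1 less_imp_le)
  have D_bound: "\<bar>D x\<bar> \<le> c2" for x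
    using assms(10)[OF fr01, of x] by (simp add: D_eq periodic1_frac[OF per'])
  have h_lower: "c1 \<le> h x" for x
    using assms(9)[OF fr01, of x] by (simp add: periodic1_frac[OF per])
  have h_cont: "continuous_on UNIV h"
    by (rule DERIV_continuous_on[of _ _ D]) (rule has_field_derivative_at_within[OF D])
  have [measurable]: "h \<in> borel_measurable borel" by (rule borel_measurable_continuous_onI[OF h_cont])
  obtain K where K: "\<And>x. \<bar>h x\<bar> \<le> K" using periodic1_bounded[OF per h_cont] by blast
  have h_upper: "h x \<le> K" for x using K[of x] by simp
  have c1K: "c1 \<le> K" using h_lower[of 0] h_upper[of 0] by simp
  have K0: "0 < K" using c1K \<open>c1 > 0\<close> by simp
  have p_density: "p x = density torus (\<lambda>y. ennreal (h (y - f x)))" for x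
    unfolding p_def noise_kernel_def by (rule distr_torus_translate_density[OF per h_cont assms(5)])
  have W: "\<omega> 0 \<in> M \<rightarrow>\<^sub>M torus" using assms(5)[of 0] by (simp add: distributed_def)
  have p: "p \<in> torus \<rightarrow>\<^sub>M prob_algebra torus"
    unfolding p_def by (rule noise_kernel_measurable[OF \<open>prob_space M\<close> f W])
  \<comment> \<open>Read off from \<open>p x\<close> being a probability measure, without
    integrating h over a shifted period.\<close>
  have mass: "(\<integral>\<^sup>+y. ennreal (h (y - f x)) \<partial>torus) = 1" if "x \<in> space torus" for x
  proof -
    have "prob_space (p x)" using measurable_space[OF p that] by (simp add: space_prob_algebra)
    then have "emeasure (p x) (space (p x)) = 1" by (rule prob_space.emeasure_space_1)
    then show ?thesis
      by (simp add: p_density emeasure_density cong: nn_integral_cong)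
  qed
  have k_meas: "(\<lambda>(x, y). h (y - f x)) \<in> borel_measurable (torus \<Otimes>\<^sub>M torus)"
    by (simp add: case_prod_beta')
  obtain g where g[measurable]: "g \<in> borel_measurable torus"
    and g_bounds: "\<And>y. y \<in> space torus \<Longrightarrow> c1 \<le> g y \<and> g y \<le> K"
    and g_mass: "(\<integral>x. g x \<partial>torus) = 1"
    and g_fix: "\<And>y. y \<in> space torus \<Longrightarrow> g y = (\<integral>x. h (y - f x) * g x \<partial>torus)"
    by (rule doeblin_stationary_density[OF prob_space_torus k_meas \<open>c1 > 0\<close> h_lower h_upper mass])
      (assumption | rule that)+
  have g_pos: "0 < g y" if "y \<in> space torus" for y using g_bounds[OF that] \<open>c1 > 0\<close> by simp
  have g_int: "integrable torus g"
    by (rule torus.integrable_const_bound[of _ K]) (use g_bounds g_pos in \<open>auto intro!: AE_I2 simp: less_imp_le\<close>)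
  define \<mu> where "\<mu> = density torus (\<lambda>x. ennreal (g x))"
  have sets_\<mu>[measurable_cong, simp]: "sets \<mu> = sets torus" and space_\<mu>[simp]: "space \<mu> = space torus"
    by (simp_all add: \<mu>_def)
  have borel_\<mu>: "borel_measurable \<mu> = (borel_measurable torus :: (real \<Rightarrow> real) set)"
    by (rule measurable_cong_sets) simp_all
  have integrable_\<mu>: "integrable \<mu> \<phi> \<longleftrightarrow> integrable torus (\<lambda>x. g x * \<phi> x)"
    and integral_\<mu>: "(\<integral>x. \<phi> x \<partial>\<mu>) = (\<integral>x. g x * \<phi> x \<partial>torus)"
    if "\<phi> \<in> borel_measurable torus" for \<phi> :: "real \<Rightarrow> real"
    unfolding \<mu>_def using that g_pos
    by (subst integrable_density integral_density; auto intro!: AE_I2 less_imp_le)+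
  have AE_\<mu>: "(AE x in \<mu>. P x) \<longleftrightarrow> (AE x in torus. P x)" for P
    unfolding \<mu>_def by (subst AE_density) (use g_pos in \<open>auto intro!: AE_cong\<close>)
  have prob_\<mu>: "prob_space \<mu>"
  proof (rule prob_spaceI)
    have "(\<integral>\<^sup>+x. ennreal (g x) \<partial>torus) = 1"
      using nn_integral_eq_integral[OF g_int] g_pos by (simp add: g_mass AE_I2 less_imp_le)
    then show "emeasure \<mu> (space \<mu>) = 1"
      by (simp add: \<mu>_def emeasure_density cong: nn_integral_cong)
  qed
  interpret \<mu>: prob_space \<mu> by (rule prob_\<mu>)
  \<comment> \<open>Both h and g take values in [c1, K] (g on [0,1)), so q lies between c1/K and
    K/c1.\<close>
  define q where "q x y = h (y - f x) / g y" for x y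
  \<comment> \<open>The factor 2 keeps \<open>\<delta> < 1\<close> when \<open>h\<close> is constant.\<close>
  define \<delta> where "\<delta> = c1 / (2 * K)"
  define B where "B = K / c1"
  interpret q: stationary_density \<mu> q \<delta> B
  proof
    show "case_prod q \<in> borel_measurable (\<mu> \<Otimes>\<^sub>M \<mu>)"
      unfolding q_def by (simp add: case_prod_beta')
    show "0 < \<delta>" "\<delta> < 1" using \<open>c1 > 0\<close> c1K K0 by (simp_all add: \<delta>_def)
    fix x y assume x: "x \<in> space \<mu>" and y: "y \<in> space \<mu>"
    have y': "y \<in> space torus" using y by simp
    have "\<delta> \<le> c1 / K" using \<open>c1 > 0\<close> K0 by (simp add: \<delta>_def field_simps)
    also have "\<dots> \<le> q x y"
      unfolding q_def using h_lower \<open>c1 > 0\<close> g_bounds[OF y'] g_pos[OF y']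
      by (intro frac_le) (auto intro: order_trans[OF less_imp_le[OF \<open>c1 > 0\<close>]])
    finally show "\<delta> \<le> q x y" .
    show "q x y \<le> B"
      unfolding q_def B_def using h_upper \<open>c1 > 0\<close> g_bounds[OF y'] K0 by (intro frac_le) auto
  next
    fix x assume x: "x \<in> space \<mu>"
    have "(\<integral>y. q x y \<partial>\<mu>) = (\<integral>y. h (y - f x) \<partial>torus)"
      unfolding q_def by (subst integral_\<mu>) (auto intro!: Bochner_Integration.integral_cong dest: g_pos)
    also have "\<dots> = 1"
      using mass[of x] x order_trans[OF less_imp_le[OF \<open>c1 > 0\<close>] h_lower]
      by (subst integral_eq_nn_integral) auto
    finally show "(\<integral>y. q x y \<partial>\<mu>) = 1" .
  next
    fix y assume "y \<in> space \<mu>"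
    then have y: "y \<in> space torus" by simp
    \<comment> \<open>The column condition is the fixed-point equation of g divided by
      \<open>g y\<close>.\<close>
    have "(\<integral>x. q x y \<partial>\<mu>) = (\<integral>x. h (y - f x) * g x / g y \<partial>torus)"
      unfolding q_def by (subst integral_\<mu>) (auto simp: mult.commute)
    then show "(\<integral>x. q x y \<partial>\<mu>) = 1"
      using g_fix[OF y] g_pos[OF y] by simp
  qed
  have pq: "p x = density \<mu> (\<lambda>y. ennreal (q x y))" for x
    unfolding p_density \<mu>_def q_def
    by (subst density_density_eq)
       (auto intro!: density_cong AE_I2 simp: less_imp_le g_pos simp flip: ennreal_mult' dest: g_pos)
  have st: "stationary_measure torus p \<mu>"
    unfolding stationary_measure_def
  proof (intro conjI prob_\<mu> sets_\<mu>)
    have "p \<in> \<mu> \<rightarrow>\<^sub>M subprob_algebra \<mu>"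
      using measurable_prob_algebraD[OF p] subprob_algebra_cong[OF sets_\<mu>]
        measurable_cong_sets[OF sets_\<mu> refl] by auto
    then show "\<mu> \<bind> p = \<mu>" by (rule q.bind_stationary) (rule pq)
  qed
  \<comment> \<open>The density g is strictly positive at every point, so \<open>AE_\<mu>\<close>
    identifies the null sets.\<close>
  have eqv: "equivalent_measures \<mu> torus"
  proof -
    have "A \<in> null_sets \<mu> \<longleftrightarrow> A \<in> null_sets torus" for A
    proof (cases "A \<in> sets torus")
      case True
      then show ?thesis using AE_\<mu>[of "\<lambda>x. x \<notin> A"] by (simp add: AE_iff_null_sets)
    next
      case False
      then show ?thesis using null_setsD2 sets_\<mu> by blast
    qed
    then show ?thesis by (auto simp: equivalent_measures_def absolutely_continuous_def)
  qed
  have T_meas: "q.T \<phi> \<in> borel_measurable \<mu>" if "\<phi> \<in> L2 \<mu>" for \<phi>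
    by (rule q.T_measurable) (use that in \<open>simp add: L2_def\<close>)
  have T_L2: "q.T \<phi> \<in> L2 \<mu>" "L2_norm \<mu> (q.T \<phi>) \<le> B * L2_norm \<mu> \<phi>" if \<phi>: "\<phi> \<in> L2 \<mu>" for \<phi>
  proof -
    have B0: "0 \<le> B" using K0 \<open>c1 > 0\<close> by (simp add: B_def)
    have "\<bar>q.T \<phi> y\<bar> \<le> B * L2_norm \<mu> \<phi>" if "y \<in> space \<mu>" for y
      by (rule order_trans[OF q.abs_T_le[OF \<mu>.integral_abs_le_L2_norm(1)[OF \<phi>] that]
          mult_left_mono[OF \<mu>.integral_abs_le_L2_norm(2)[OF \<phi>] B0]])
    then have "AE y in \<mu>. \<bar>q.T \<phi> y\<bar> \<le> B * L2_norm \<mu> \<phi>" by (rule AE_I2)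
    then show "q.T \<phi> \<in> L2 \<mu>" "L2_norm \<mu> (q.T \<phi>) \<le> B * L2_norm \<mu> \<phi>"
      by (rule \<mu>.L2_bounded[OF T_meas[OF \<phi>]])+
  qed
  have P_ae: "AE y in \<mu>. transfer_op p \<mu> \<phi> y = q.T \<phi> y" if "\<phi> \<in> L2 \<mu>" for \<phi>
    by (rule q.transfer_op_AE_eq_T[OF p st pq]) (rule \<mu>.integral_abs_le_L2_norm(1)[OF that])
  have P_meas: "transfer_op p \<mu> \<phi> \<in> borel_measurable \<mu>" if "\<phi> \<in> L2 \<mu>" for \<phi>
    using transfer_op(1)[OF p st \<mu>.integral_abs_le_L2_norm(1)[OF that]] by simp
  have P_T: "transfer_op p \<mu> \<phi> \<in> L2 \<mu>" "L2_norm \<mu> (transfer_op p \<mu> \<phi>) = L2_norm \<mu> (q.T \<phi>)"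
    if \<phi>: "\<phi> \<in> L2 \<mu>" for \<phi>
    using L2_cong_AE[OF P_ae[OF \<phi>] P_meas[OF \<phi>] T_meas[OF \<phi>]] T_L2(1)[OF \<phi>] by simp_all
  \<comment> \<open>\<open>g_fix\<close> speaks only of [0,1). The integral is 1-periodic in y, so y
    may be replaced by its fractional part, where it equals g.\<close>
  have G_lower: "c1 \<le> (\<integral>x. h (y - f x) * g x \<partial>torus)" for y
  proof -
    have "h (frac y - f x) = h (y - f x)" for x
    proof -
      have "frac (frac y - f x) = frac (y - f x + of_int (- \<lfloor>y\<rfloor>))"
        by (simp add: frac_def algebra_simps)
      then have "frac (frac y - f x) = frac (y - f x)" by (simp only: frac_add_of_int_right)
      then show ?thesis by (metis periodic1_frac[OF per])
    qed
    moreover have "frac y \<in> space torus" by (simp add: space_torus frac_lt_1)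
    ultimately show ?thesis using g_bounds[of "frac y"] g_fix[of "frac y"] by simp
  qed
  \<comment> \<open>The constant of the quotient estimate for |h| \<le> K, |h'| \<le> c2 and
    denominator at least c1.\<close>
  define R where "R = c2 / c1 + K * c2 / c1\<^sup>2"
  have R0: "0 < R" using \<open>c1 > 0\<close> \<open>c2 > 0\<close> K0 by (simp add: R_def add_pos_pos)
  have g_abs: "(\<integral>x. \<bar>g x\<bar> \<partial>torus) = 1"
    using g_pos by (simp add: g_mass less_imp_le cong: Bochner_Integration.integral_cong)
  have regular: "\<exists>\<phi>'\<in>L2 \<mu>. has_weak_derivative (transfer_op p \<mu> \<phi>) \<phi>' \<and> L2_norm \<mu> \<phi>' \<le> R * L2_norm \<mu> \<phi>"
    if \<phi>: "\<phi> \<in> L2 \<mu>" for \<phi>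
  proof -
    have [measurable]: "\<phi> \<in> borel_measurable torus" using \<phi> by (simp add: L2_def borel_\<mu>)
    \<comment> \<open>The Lebesgue density of the signed measure \<phi> d\<mu>.\<close>
    define w where "w x = g x * \<phi> x" for x
    have w: "integrable torus w"
      using \<mu>.integral_abs_le_L2_norm(1)[OF \<phi>] integrable_\<mu>[of \<phi>] by (simp add: w_def[abs_def])
    have "(\<integral>x. \<bar>w x\<bar> \<partial>torus) = (\<integral>x. \<bar>\<phi> x\<bar> \<partial>\<mu>)"
      using g_pos
      by (subst integral_\<mu>) (auto intro!: Bochner_Integration.integral_cong simp: w_def abs_mult less_imp_le)
    then have w_le: "(\<integral>x. \<bar>w x\<bar> \<partial>torus) \<le> L2_norm \<mu> \<phi>"
      using \<mu>.integral_abs_le_L2_norm(2)[OF \<phi>] by simp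
    \<comment> \<open>A representative of the image on the whole line: on [0,1) the denominator is
      \<open>g y\<close>, so F agrees there with \<open>q.T \<phi>\<close>.\<close>
    define F where "F y = (\<integral>x. h (y - f x) * w x \<partial>torus) / (\<integral>x. h (y - f x) * g x \<partial>torus)" for y
    obtain F' where F': "\<And>y. (F has_real_derivative F' y) (at y)" and F'_cont: "\<And>y. isCont F' y"
      and F'_le: "\<And>y. \<bar>F' y\<bar> \<le> R * (\<integral>x. \<bar>w x\<bar> \<partial>torus)"
      by (rule quotient_integral_translate_C1[OF D D_cont K D_bound f g_int g_abs w \<open>c1 > 0\<close> G_lower,
            folded F_def[abs_def] R_def])
        (assumption | rule that)+
    have perF: "periodic1 F"
    proof -
      have "h (y + 1 - a) = h (y - a)" for y a
        using per unfolding periodic1_def by (metis add.commute add_diff_eq)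
      then show ?thesis by (simp add: periodic1_def F_def)
    qed
    have TF: "q.T \<phi> y = F y" if y: "y \<in> space torus" for y
    proof -
      have "q.T \<phi> y = (\<integral>x. h (y - f x) * w x / g y \<partial>torus)"
        unfolding q.T_def q_def w_def by (subst integral_\<mu>) (auto simp: ac_simps)
      then show ?thesis by (simp add: F_def flip: g_fix[OF y])
    qed
    have "AE y in \<mu>. transfer_op p \<mu> \<phi> y = F y"
      using P_ae[OF \<phi>] AE_space by eventually_elim (simp add: TF)
    then have weak: "has_weak_derivative (transfer_op p \<mu> \<phi>) F'"
      using has_weak_derivative_C1[OF F' F'_cont perF] P_meas[OF \<phi>]
      by (simp add: AE_\<mu> borel_\<mu>)
    have "F' \<in> borel_measurable torus"
      using F'_cont by (intro measurable_torusI borel_measurable_continuous_onI)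
        (simp add: continuous_on_eq_continuous_at)
    then have F'm: "F' \<in> borel_measurable \<mu>" by (simp add: borel_\<mu>)
    have F'b: "AE y in \<mu>. \<bar>F' y\<bar> \<le> R * L2_norm \<mu> \<phi>"
      using order_trans[OF F'_le mult_left_mono[OF w_le]] R0 by (intro AE_I2) auto
    show ?thesis
      using \<mu>.L2_bounded[OF F'm F'b] weak by auto
  qed
  have contraction: "L2_norm \<mu> (transfer_op p \<mu> \<phi>) \<le> (1 - \<delta>) * L2_norm \<mu> \<phi>"
    if "\<phi> \<in> L2 \<mu>" "(\<integral>x. \<phi> x \<partial>\<mu>) = 0" for \<phi>
    using q.T_contraction[OF that] by (simp add: P_T(2)[OF that(1)])
  \<comment> \<open>B controls the function and R its derivative, so B + R bounds the map into the
    Sobolev space.\<close>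
  have sum_le: "L2_norm \<mu> (transfer_op p \<mu> \<phi>) + s \<le> (B + R) * L2_norm \<mu> \<phi>"
    if "\<phi> \<in> L2 \<mu>" "s \<le> R * L2_norm \<mu> \<phi>" for \<phi> s
    using T_L2(2)[OF that(1)] that(2) by (simp add: P_T(2)[OF that(1)] distrib_right)
  have BR: "0 < B + R" using K0 \<open>c1 > 0\<close> R0 by (simp add: B_def add_pos_pos)
  show ?thesis
  proof (intro exI[of _ \<mu>] conjI st eqv)
    show "\<exists>\<gamma>. 0 < \<gamma> \<and> \<gamma> < 1 \<and> (\<forall>\<phi>\<in>L2 \<mu>. (\<integral>x. \<phi> x \<partial>\<mu>) = 0 \<longrightarrow>
        transfer_op p \<mu> \<phi> \<in> L2 \<mu> \<and> L2_norm \<mu> (transfer_op p \<mu> \<phi>) \<le> \<gamma> * L2_norm \<mu> \<phi>)"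
      using q.\<delta> P_T(1) contraction by (intro exI[of _ "1 - \<delta>"]) auto
    show "\<exists>C\<^sub>r>0. \<exists>C>0. \<forall>\<phi>\<in>L2 \<mu>. transfer_op p \<mu> \<phi> \<in> L2 \<mu> \<and>
      (\<exists>\<phi>'\<in>L2 \<mu>. has_weak_derivative (transfer_op p \<mu> \<phi>) \<phi>' \<and>
        L2_norm \<mu> \<phi>' \<le> C\<^sub>r * L2_norm \<mu> \<phi> \<and>
        L2_norm \<mu> (transfer_op p \<mu> \<phi>) + L2_norm \<mu> \<phi>' \<le> C * L2_norm \<mu> \<phi>)"
    proof (rule exI[of _ R], rule conjI[OF R0], rule exI[of _ "B + R"], rule conjI[OF BR], intro ballI conjI)
      fix \<phi> assume \<phi>: "\<phi> \<in> L2 \<mu>"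
      show "transfer_op p \<mu> \<phi> \<in> L2 \<mu>" by (rule P_T(1)[OF \<phi>])
      obtain \<phi>' where \<phi>': "\<phi>' \<in> L2 \<mu>" "has_weak_derivative (transfer_op p \<mu> \<phi>) \<phi>'"
        "L2_norm \<mu> \<phi>' \<le> R * L2_norm \<mu> \<phi>"
        using regular[OF \<phi>] by blast
      then show "\<exists>\<phi>'\<in>L2 \<mu>. has_weak_derivative (transfer_op p \<mu> \<phi>) \<phi>' \<and>
          L2_norm \<mu> \<phi>' \<le> R * L2_norm \<mu> \<phi> \<and>
          L2_norm \<mu> (transfer_op p \<mu> \<phi>) + L2_norm \<mu> \<phi>' \<le> (B + R) * L2_norm \<mu> \<phi>"
        using sum_le[OF \<phi> \<phi>'(3)] by (intro bexI[of _ \<phi>'] conjI)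
    qed
  qed
qed

end
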